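(* Let $\epsilon>0$, $\sigma\geq\frac12+\epsilon$, $l\in\mathbb{N}$ be fixed. For $x,y,z,n\in\mathbb{N}$ with $n\geq3$ let $r=\frac{x^n+y^n}{z^n}$ and \[ K(x,y,z,n)=\lim_{\tau\to\infty}\frac1\tau\left\{\frac{1}{1-c}\int_{\frac{r}{3}\tau}^{\varphi_1^{-1}(\frac{r}{3}\tau)}\left|\zeta\left(\tfrac12+it\right)\right|^2{\rm d}t+\frac{1}{\zeta(2\sigma)}\int_1^{\frac r3\tau}|\zeta(\sigma+it)|^2{\rm d}t+\frac{1}{\bar{c}(l)}\int_1^{\frac r3\tau}|S_1(t)|^{2l}{\rm d}t\right\}. \] Then the following are equivalent: (i) (Fermat–Wiles theorem) there are no $x,y,z,n\in\mathbb{N}$ with $n\geq3$ and $x^n+y^n=z^n$; (ii) $K(x,y,z,n)\neq1$ for all $x,y,z,n\in\mathbb{N}$ with $n\geq3$.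
   Context: $\zeta$ is the Riemann zeta-function and $c$ is Euler's constant. $S(t)=\frac1\pi\arg\zeta(\frac12+it)$ (argument defined by continuous variation in the usual way) and $S_1(t)=\int_0^t S(u)\,{\rm d}u$. For $l\in\mathbb{N}$, $\bar{c}(l)>0$ is the constant in Selberg's formula $\int_1^T|S_1(t)|^{2l}{\rm d}t=\bar{c}(l)T+O(T/\ln T)$ as $T\to\infty$. $\varphi_1$ denotes a Jacob's ladder (in the sense of Moser): an increasing function whose inverse $\varphi_1^{-1}(T)$ is defined for all sufficiently large $T$, satisfies $T<\varphi_1^{-1}(T)$, and for every fixed small $\delta>0$ satisfies $\int_T^{\varphi_1^{-1}(T)}|\zeta(\frac12+it)|^2{\rm d}t=(1-c)T+O(T^{1/3+\delta})$ as $T\to\infty$. *)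

theory Defs
  imports "HOL-Complex_Analysis.Complex_Analysis" "HOL-Library.Landau_Symbols"
begin

(* Analytic continuation of the Dirichlet series: zeta s is the value at s of the holomorphic
   function on a punctured half-plane {Re z > a} - {1} containing s that agrees with the series
   where the latter converges absolutely. These domains are connected and nested, so the value
   depends neither on a nor on f. The value at the pole is a dummy. *)
definition zeta :: "complex \<Rightarrow> complex" where
  "zeta s = (if s = 1 then 0 else
     (THE w. \<exists>a f. a < Re s \<and> f holomorphic_on ({z. Re z > a} - {1}) \<and>
        (\<forall>z. Re z > a \<and> Re z > 1 \<longrightarrow> f z = (\<Sum>n. 1 / of_nat (Suc n) powr z)) \<and> f s = w))"

(* Final value of the argument of f, continued continuously along the path g from the
   principal argument at the start. Meaningful if f is continuous and nonzero on g. *)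
definition arg_along :: "(complex \<Rightarrow> complex) \<Rightarrow> (real \<Rightarrow> complex) \<Rightarrow> real" where
  "arg_along f g = (THE a. \<exists>\<theta>. continuous_on {0..1} \<theta> \<and> \<theta> 0 = Arg (f (g 0)) \<and>
     (\<forall>u\<in>{0..1}. is_Arg (f (g u)) (\<theta> u)) \<and> \<theta> 1 = a)"

definition S_path :: "real \<Rightarrow> real \<Rightarrow> complex" where
  "S_path t = linepath 2 (Complex 2 t) +++ linepath (Complex 2 t) (Complex (1/2) t)"

(* The usual convention: the argument varies along the segments joining 2, 2 + it, 1/2 + it,
   starting from arg (zeta 2) = 0. If a zero of zeta (or, for t = 0, the pole) lies on this path,
   S t is the mean of its two one-sided limits. This concerns a discrete set of t only. *)
definition S :: "real \<Rightarrow> real" where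
  "S t = (let S0 = (\<lambda>t. arg_along zeta (S_path t) / pi) in
     if 0 \<notin> zeta ` path_image (S_path t) then S0 t
     else Lim (at_right 0) (\<lambda>h. (S0 (t + h) + S0 (t - h)) / 2))"

definition S1 :: "real \<Rightarrow> real" where
  "S1 t = integral {0..t} S"

definition selberg_constant :: "nat \<Rightarrow> real \<Rightarrow> bool" where
  "selberg_constant l C \<longleftrightarrow> C > 0 \<and>
     (\<lambda>T. integral {1..T} (\<lambda>t. \<bar>S1 t\<bar> ^ (2 * l)) - C * T) \<in> O(\<lambda>T. T / ln T)"

(* The ladder is a function on the half-line {T0..}; its inverse is taken there. *)
definition ladder_inv :: "real \<Rightarrow> (real \<Rightarrow> real) \<Rightarrow> real \<Rightarrow> real" where
  "ladder_inv T0 \<phi> = inv_into {T0..} \<phi>"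

definition jacobs_ladder :: "real \<Rightarrow> (real \<Rightarrow> real) \<Rightarrow> bool" where
  "jacobs_ladder T0 \<phi> \<longleftrightarrow>
     strict_mono_on {T0..} \<phi> \<and>
     (\<forall>\<^sub>F T in at_top. T \<in> \<phi> ` {T0..} \<and> T < ladder_inv T0 \<phi> T) \<and>
     (\<forall>\<^sub>F \<delta> in at_right 0.
        (\<lambda>T. integral {T..ladder_inv T0 \<phi> T} (\<lambda>t. (cmod (zeta (Complex (1/2) t)))\<^sup>2)
             - (1 - euler_mascheroni) * T) \<in> O(\<lambda>T. T powr (1/3 + \<delta>)))"

(* zeta is real at the real point 2 * \<sigma> > 1; Re only converts the type.
   psi plays the role of the inverse of the ladder and C that of Selberg's constant. *)
definition K ::
  "real \<Rightarrow> nat \<Rightarrow> real \<Rightarrow> (real \<Rightarrow> real) \<Rightarrow> nat \<Rightarrow> nat \<Rightarrow> nat \<Rightarrow> nat \<Rightarrow> real" where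
  "K \<sigma> l C psi x y z n =
     (let r = (real x ^ n + real y ^ n) / real z ^ n in
      Lim at_top (\<lambda>\<tau>. 1 / \<tau> *
        (1 / (1 - euler_mascheroni) *
           integral {r / 3 * \<tau>..psi (r / 3 * \<tau>)} (\<lambda>t. (cmod (zeta (Complex (1/2) t)))\<^sup>2)
         + 1 / Re (zeta (of_real (2 * \<sigma>))) *
           integral {1..r / 3 * \<tau>} (\<lambda>t. (cmod (zeta (Complex \<sigma> t)))\<^sup>2)
         + 1 / C * integral {1..r / 3 * \<tau>} (\<lambda>t. \<bar>S1 t\<bar> ^ (2 * l)))))"

end

theory Submission imports Defs begin

text \<open>
  Each of the three terms contributes a third of r, so that K equals r and K = 1 is Fermat's
  equation. The first and the third term are covered by the hypotheses on the ladder and on Selberg's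
  constant. The second one needs the mean value theorem for the zeta function on a line to the
  right of 1/2. For Re s > 0, the formula
  zeta s = (sum of n powr (-s) over n \<le> N) + N powr (1 - s) / (s - 1)
  - s * (integral of frac x * x powr (-s-1) over x > N)
  provides the continuation. The choice N = T powr a with a < 1 close to 1 makes the
  last two terms negligible in mean square over [1, T], while the square of the sum can be
  integrated term by term. For the integral this works because, with x = n + u and u fixed, it is again
  a sum over well-spaced frequencies ln (n + u), and the Cauchy-Schwarz inequality in u suffices.
\<close>

section \<open>Analytic continuation\<close>

text \<open>The delicate range is 1/2 < \<sigma> \<le> 1. A pointwise estimate of the last term of
  the formula gives about T * N powr (-\<sigma>), whose square is small only for N beyond T powr (1
  / \<sigma>); at such a length the off-diagonal terms of the sum, bounded by about N powr (1 +
  \<eta>), are no longer controlled by T. Averaging over t removes the conflict: the integral over x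
  > N has square integral at most a constant times T * N powr (-(2 * \<sigma> + 1)) + N powr (-(2 *
  \<sigma> - \<eta>)). Multiplied by the square of |s|, of order at most T^2, and divided by T, this
  is roughly T powr (1 - 2 * \<sigma>) for N close to T, and it tends to 0 because \<sigma> > 1/2.
  The loss \<eta> and the distance of a from 1 are paid out of this margin. A second obligation
  comes from the definitions: \<open>zeta\<close> is given by \<open>THE\<close> and
  \<open>K\<close> by \<open>Lim\<close>, so uniqueness of the continuation and convergence of each
  term have to be established before any value can be read off.\<close>

text \<open>The piece over [n, n + 1] of the integral of frac x * x powr (-z-1), after the
  substitution x = n + u. All pieces then share the range of u, so that a sum over n can be taken
  under one integral sign.\<close>

definition frac_term :: "nat \<Rightarrow> complex \<Rightarrow> complex" where
  "frac_term n z = integral {0..1} (\<lambda>u. of_real u * of_real (real n + u) powr (- z - 1))"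

lemma cmod_of_real_powr: "x > 0 \<Longrightarrow> cmod (complex_of_real x powr z) = x powr Re z"
  by (simp add: norm_powr_real_powr)

lemma continuous_on_shift_powr:
  assumes "n \<ge> 1"
  shows "continuous_on {0..1} (\<lambda>u. complex_of_real (real n + u) powr w)"
  using assms by (intro continuous_intros) (auto simp: complex_nonpos_Reals_iff complex_eq_iff)

text \<open>Integration by parts. The closed form serves twice: it telescopes in n, and it shows
  that the pieces are holomorphic in z without differentiation under the integral sign.\<close>

lemma frac_term_eq:
  assumes "n \<ge> 1" "z \<noteq> 1"
  shows "z * frac_term n z =
    (of_nat (Suc n) powr (1 - z) - of_nat n powr (1 - z)) / (1 - z) - of_nat (Suc n) powr (- z)"
proof -
  define G where "G = (\<lambda>u. of_real (real n + u) powr (1 - z) / (1 - z)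
    - complex_of_real u * of_real (real n + u) powr (- z))"
  have nz: "1 - z \<noteq> 0" using assms by simp
  have "((\<lambda>u. z * (of_real u * of_real (real n + u) powr (- z - 1))) has_integral (G 1 - G 0)) {0..1}"
  proof (rule fundamental_theorem_of_calculus)
    fix u :: real assume u: "u \<in> {0..1}"
    define v where "v = complex_of_real (real n + u)"
    have v: "v \<notin> \<real>\<^sub>\<le>\<^sub>0" "v \<noteq> 0" using u assms by (auto simp: v_def complex_nonpos_Reals_iff complex_eq_iff)
    have "((\<lambda>x. (of_nat n + x) powr (1 - z) / (1 - z)) has_field_derivative v powr (- z)) (at (complex_of_real u))"
      using v nz unfolding v_def by (auto intro!: derivative_eq_intros)
    moreover have "((\<lambda>x. x * (of_nat n + x) powr (- z)) has_field_derivative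
        (v powr (- z) - of_real u * z * v powr (- z - 1))) (at (complex_of_real u))"
      using v unfolding v_def by (auto intro!: derivative_eq_intros)
    ultimately have "((\<lambda>x. (of_nat n + x) powr (1 - z) / (1 - z) - x * (of_nat n + x) powr (- z))
       has_field_derivative (v powr (- z) - (v powr (- z) - of_real u * z * v powr (- z - 1)))) (at (complex_of_real u))"
      by (rule DERIV_diff)
    also have "v powr (- z) - (v powr (- z) - of_real u * z * v powr (- z - 1)) = z * (of_real u * v powr (- z - 1))"
      by simp
    finally have "((\<lambda>x. (of_nat n + x) powr (1 - z) / (1 - z) - x * (of_nat n + x) powr (- z))
       has_field_derivative z * (of_real u * v powr (- z - 1))) (at (complex_of_real u))" .
    from has_vector_derivative_real_field[OF this]
    show "(G has_vector_derivative z * (of_real u * of_real (real n + u) powr (- z - 1))) (at u within {0..1})"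
      by (simp add: G_def v_def o_def)
  qed simp
  hence "integral {0..1} (\<lambda>u. z * (of_real u * of_real (real n + u) powr (- z - 1))) = G 1 - G 0"
    by (rule integral_unique)
  thus ?thesis
    by (simp add: frac_term_def G_def diff_divide_distrib add.commute)
qed

lemma cmod_frac_term_le:
  assumes "n \<ge> 1" "Re z > -1"
  shows "cmod (frac_term n z) \<le> real n powr (- Re z - 1)"
proof -
  have "cmod (frac_term n z) \<le> (real n powr (- Re z - 1)) * (1 - 0)"
    unfolding frac_term_def
  proof (rule integral_bound)
    show "continuous_on {0..1} (\<lambda>u. of_real u * of_real (real n + u) powr (- z - 1))"
      by (intro continuous_intros continuous_on_shift_powr assms)
    fix u :: real assume u: "u \<in> {0..1}"
    have "(real n + u) powr (- Re z - 1) \<le> real n powr (- Re z - 1)"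
      using u assms by (intro powr_mono2') auto
    thus "norm (of_real u * of_real (real n + u) powr (- z - 1)) \<le> real n powr (- Re z - 1)"
      using u assms mult_mono[of u 1 "(real n + u) powr (- Re z - 1)" "real n powr (- Re z - 1)"]
      by (simp add: norm_mult cmod_of_real_powr del: of_real_add)
  qed simp
  thus ?thesis by simp
qed

text \<open>First-order Euler-Maclaurin summation in finite form, so that no convergence is involved
  and z = 1 is the only exception. Its limit gives the Dirichlet series for Re z > 1 and the
  continuation for Re z > 0.\<close>

lemma sum_powr_eq_frac_terms:
  assumes "N \<ge> 1" "z \<noteq> 1"
  shows "(\<Sum>n=1..N. of_nat n powr (- z)) + of_nat N powr (1 - z) / (z - 1)
     = 1 + 1 / (z - 1) - (\<Sum>n=1..<N. z * frac_term n z)"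
  using assms(1)
proof (induction N rule: nat_induct_at_least)
  case base
  then show ?case by simp
next
  case (Suc N)
  have nz: "1 - z \<noteq> 0" "z - 1 \<noteq> 0" using assms by auto
  have flip: "a / (1 - z) = - (a / (z - 1))" for a
    by (metis minus_diff_eq divide_minus_right)
  have S1: "(\<Sum>n=1..Suc N. of_nat n powr (- z)) = (\<Sum>n=1..N. of_nat n powr (- z)) + of_nat (Suc N) powr (-z)"
    using Suc by simp
  have S2: "(\<Sum>n=1..<Suc N. z * frac_term n z) = (\<Sum>n=1..<N. z * frac_term n z) + z * frac_term N z"
    using Suc by simp
  show ?case
    unfolding S1 S2 frac_term_eq[OF Suc.hyps assms(2)] flip diff_divide_distrib
    using Suc.IH by (simp add: algebra_simps)
qed

lemma summable_frac_term:
  assumes "Re z > 0"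
  shows "summable (\<lambda>n. frac_term (n + Suc k) z)"
proof (rule summable_comparison_test)
  have "summable (\<lambda>n. real n powr (- Re z - 1))"
    using assms by (simp add: summable_real_powr_iff)
  thus "summable (\<lambda>n. real (n + Suc k) powr (- Re z - 1))"
    by (subst summable_iff_shift)
  show "\<exists>N. \<forall>n\<ge>N. norm (frac_term (n + Suc k) z) \<le> real (n + Suc k) powr (- Re z - 1)"
    using assms by (intro exI allI impI cmod_frac_term_le) auto
qed

text \<open>The continuation formula for N = 1. Moving initial terms of the series into the finite
  sum gives every other N, so N may later vary with T while the function stays the same.\<close>

definition zeta_ext :: "complex \<Rightarrow> complex" where
  "zeta_ext z = 1 + 1 / (z - 1) - (\<Sum>n. z * frac_term (Suc n) z)"

lemma zeta_ext_eq:
  assumes "Re z > 0" "z \<noteq> 1" "N \<ge> 1"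
  shows "zeta_ext z = (\<Sum>n=1..N. of_nat n powr (- z)) + of_nat N powr (1 - z) / (z - 1)
     - z * (\<Sum>n. frac_term (n + N) z)"
proof -
  have s: "summable (\<lambda>n. z * frac_term (Suc n) z)"
    using summable_frac_term[OF assms(1), of 0] by (intro summable_mult) simp
  have "(\<Sum>n. z * frac_term (Suc n) z) =
      (\<Sum>n. z * frac_term (Suc (n + (N - 1))) z) + (\<Sum>n<N-1. z * frac_term (Suc n) z)"
    by (rule suminf_split_initial_segment[OF s])
  also have "(\<Sum>n. z * frac_term (Suc (n + (N - 1))) z) = z * (\<Sum>n. frac_term (n + N) z)"
    using summable_frac_term[OF assms(1), of "N - 1"] assms(3) by (subst suminf_mult) simp_all
  also have "(\<Sum>n<N-1. z * frac_term (Suc n) z) = (\<Sum>n=1..<N. z * frac_term n z)"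
    by (rule sum.reindex_bij_witness[of _ "\<lambda>n. n - 1" Suc]) auto
  finally show ?thesis
    using sum_powr_eq_frac_terms[OF assms(3,2)] by (simp add: zeta_ext_def algebra_simps)
qed

lemma holomorphic_zeta_ext: "zeta_ext holomorphic_on ({z. Re z > 0} - {1})"
proof -
  let ?S = "{z. Re z > 0} - {1}"
  have op: "open ?S" by (intro open_Diff open_halfspace_Re_gt) auto
  have "(\<lambda>z. \<Sum>n. z * frac_term (Suc n) z) holomorphic_on ?S"
  proof (rule holomorphic_uniform_sequence[OF op])
    fix M
    have "(\<lambda>z. \<Sum>n<M. ((of_nat (Suc (Suc n)) powr (1 - z) - of_nat (Suc n) powr (1 - z)) / (1 - z)
        - of_nat (Suc (Suc n)) powr (- z))) holomorphic_on ?S"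
      by (intro holomorphic_intros) auto
    thus "(\<lambda>z. \<Sum>n<M. z * frac_term (Suc n) z) holomorphic_on ?S"
      by (rule holomorphic_transform) (auto simp: frac_term_eq simp del: of_nat_Suc)
  next
    fix x assume x: "x \<in> ?S"
    then obtain d0 where d0: "d0 > 0" "cball x d0 \<subseteq> ?S"
      using op open_contains_cball by blast
    \<comment> \<open>The bound Re x / 2 on the radius keeps Re z \<ge> Re x / 2 on the whole disc,
      which yields one summable majorant.\<close>
    define d where "d = min d0 (Re x / 2)"
    have d: "d > 0" "d \<le> d0" "d \<le> Re x / 2" using d0 x by (auto simp: d_def)
    have "uniform_limit (cball x d) (\<lambda>M z. \<Sum>n<M. z * frac_term (Suc n) z)
            (\<lambda>z. \<Sum>n. z * frac_term (Suc n) z) sequentially"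
    proof (rule Weierstrass_m_test)
      have "summable (\<lambda>n. real n powr (- (Re x / 2) - 1))"
        using x by (simp add: summable_real_powr_iff)
      hence "summable (\<lambda>n. real (n + 1) powr (- (Re x / 2) - 1))"
        by (subst summable_iff_shift)
      thus "summable (\<lambda>n. (cmod x + d) * real (n + 1) powr (- (Re x / 2) - 1))"
        by (rule summable_mult)
      fix n z assume z: "z \<in> cball x d"
      have "\<bar>Re (x - z)\<bar> \<le> d" using z abs_Re_le_cmod[of "x - z"] by (simp add: dist_norm)
      hence Rez: "Re z \<ge> Re x / 2" using d by simp
      have Re0: "Re x > 0" using x by simp
      have "cmod z \<le> cmod x + d"
        using z norm_triangle_ineq[of x "z - x"] by (simp add: dist_norm norm_minus_commute)
      moreover have "cmod (frac_term (Suc n) z) \<le> real (n + 1) powr (- (Re x / 2) - 1)"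
      proof -
        have "cmod (frac_term (Suc n) z) \<le> real (Suc n) powr (- Re z - 1)"
          using Rez Re0 by (intro cmod_frac_term_le) auto
        also have "\<dots> \<le> real (Suc n) powr (- (Re x / 2) - 1)"
          using Rez by (intro powr_mono) auto
        finally show ?thesis by simp
      qed
      ultimately show "norm (z * frac_term (Suc n) z) \<le> (cmod x + d) * real (n + 1) powr (- (Re x / 2) - 1)"
        unfolding norm_mult using d by (intro mult_mono) auto
    qed
    thus "\<exists>d>0. cball x d \<subseteq> ?S \<and> uniform_limit (cball x d)
       (\<lambda>M z. \<Sum>n<M. z * frac_term (Suc n) z) (\<lambda>z. \<Sum>n. z * frac_term (Suc n) z) sequentially"
      using d d0 by (intro exI[of _ d]) force
  qed
  thus ?thesis unfolding zeta_ext_def by (intro holomorphic_intros) auto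
qed

lemma zeta_ext_sums:
  assumes "Re z > 1"
  shows "(\<lambda>n. 1 / of_nat (Suc n) powr z) sums zeta_ext z"
proof -
  have z1: "z \<noteq> 1" using assms by auto
  have "(\<lambda>N. cmod (of_nat N powr (1 - z))) \<longlonglongrightarrow> 0"
  proof (rule Lim_transform_eventually)
    show "(\<lambda>N. real N powr (1 - Re z)) \<longlonglongrightarrow> 0"
      using assms by (intro tendsto_neg_powr filterlim_real_sequentially) auto
    show "\<forall>\<^sub>F N in sequentially. real N powr (1 - Re z) = cmod (of_nat N powr (1 - z))"
      using eventually_gt_at_top[of 0] by eventually_elim (metis cmod_of_real_powr of_nat_0_less_iff of_real_of_nat_eq minus_complex.sel(1) one_complex.sel(1))
  qed
  hence l1: "(\<lambda>N. of_nat N powr (1 - z)) \<longlonglongrightarrow> 0" by (rule tendsto_norm_zero_cancel)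
  have "(\<lambda>n. z * frac_term (Suc n) z) sums (\<Sum>n. z * frac_term (Suc n) z)"
    using summable_frac_term[of z 0] assms by (intro summable_sums summable_mult) auto
  hence l2: "(\<lambda>N. \<Sum>n<N. z * frac_term (Suc n) z) \<longlonglongrightarrow> (\<Sum>n. z * frac_term (Suc n) z)"
    by (simp add: sums_def)
  \<comment> \<open>The finite identity starts at one summand, hence \<open>Suc N\<close>. Its
    boundary term vanishes in the limit only because Re z > 1.\<close>
  have "(\<lambda>N. 1 + 1 / (z - 1) - (\<Sum>n<N. z * frac_term (Suc n) z) - of_nat (Suc N) powr (1 - z) / (z - 1))
     \<longlonglongrightarrow> 1 + 1 / (z - 1) - (\<Sum>n. z * frac_term (Suc n) z) - 0 / (z - 1)"
    using z1 by (intro tendsto_intros l2 LIMSEQ_Suc[OF l1]) auto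
  moreover have "1 + 1 / (z - 1) - (\<Sum>n<N. z * frac_term (Suc n) z) - of_nat (Suc N) powr (1 - z) / (z - 1)
     = (\<Sum>n<Suc N. 1 / of_nat (Suc n) powr z)" for N
  proof -
    have "(\<Sum>n<N. z * frac_term (Suc n) z) = (\<Sum>n=1..<Suc N. z * frac_term n z)"
      by (rule sum.reindex_bij_witness[of _ "\<lambda>n. n - 1" Suc]) auto
    moreover have "(\<Sum>n<Suc N. 1 / of_nat (Suc n) powr z) = (\<Sum>n=1..Suc N. of_nat n powr (- z))"
      by (rule sum.reindex_bij_witness[of _ "\<lambda>n. n - 1" Suc]) (auto simp: powr_minus divide_inverse)
    ultimately show ?thesis
      using sum_powr_eq_frac_terms[of "Suc N" z] z1 by (simp add: algebra_simps)
  qed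
  ultimately have "(\<lambda>N. \<Sum>n<Suc N. 1 / of_nat (Suc n) powr z) \<longlonglongrightarrow> zeta_ext z"
    by (simp add: zeta_ext_def)
  thus ?thesis unfolding sums_def by (rule LIMSEQ_imp_Suc)
qed

lemma connected_punctured_halfplane: "connected ({z. Re z > a} - {w})"
  by (intro connected_open_delete open_halfspace_Re_gt convex_connected convex_halfspace_Re_gt) auto

lemma zeta_eq_zeta_ext:
  assumes "Re s > 0" "s \<noteq> 1"
  shows "zeta s = zeta_ext s"
proof -
  have "(THE w. \<exists>a f. a < Re s \<and> f holomorphic_on ({z. Re z > a} - {1}) \<and>
        (\<forall>z. Re z > a \<and> Re z > 1 \<longrightarrow> f z = (\<Sum>n. 1 / of_nat (Suc n) powr z)) \<and> f s = w) = zeta_ext s"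
  proof (rule the_equality)
    show "\<exists>a f. a < Re s \<and> f holomorphic_on ({z. Re z > a} - {1}) \<and>
        (\<forall>z. Re z > a \<and> Re z > 1 \<longrightarrow> f z = (\<Sum>n. 1 / of_nat (Suc n) powr z)) \<and> f s = zeta_ext s"
      using assms holomorphic_zeta_ext zeta_ext_sums
      by (intro exI[of _ 0] exI[of _ zeta_ext]) (auto simp: sums_iff)
  next
    fix w assume "\<exists>a f. a < Re s \<and> f holomorphic_on ({z. Re z > a} - {1}) \<and>
        (\<forall>z. Re z > a \<and> Re z > 1 \<longrightarrow> f z = (\<Sum>n. 1 / of_nat (Suc n) powr z)) \<and> f s = w"
    then obtain a f where f: "a < Re s" "f holomorphic_on ({z. Re z > a} - {1})"
      "\<And>z. Re z > a \<Longrightarrow> Re z > 1 \<Longrightarrow> f z = (\<Sum>n. 1 / of_nat (Suc n) powr z)" "f s = w" by blast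
    \<comment> \<open>A competitor f may live on a larger or a smaller half-plane than
      \<open>zeta_ext\<close>. Right of b both are holomorphic off 1 and the domain still contains
      s; right of \<open>max b 1\<close> both equal the series.\<close>
    define b where "b = max a 0"
    define x :: complex where "x = of_real (max b 1 + 1)"
    have "f s - zeta_ext s = 0"
    proof (rule analytic_continuation_open[where f = "\<lambda>z. f z - zeta_ext z" and g = "\<lambda>_. 0"])
      show "open {z. Re z > max b 1}" "open ({z. Re z > b} - {1})"
        by (intro open_Diff open_halfspace_Re_gt; simp)+
      show "connected ({z. Re z > b} - {1})" by (rule connected_punctured_halfplane)
      show "{z. Re z > max b 1} \<noteq> {}" by (auto intro!: exI[of _ x] simp: x_def)
      show "{z. Re z > max b 1} \<subseteq> {z. Re z > b} - {1}" by auto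
      show "(\<lambda>z. f z - zeta_ext z) holomorphic_on {z. Re z > b} - {1}"
        by (intro holomorphic_intros holomorphic_on_subset[OF f(2)] holomorphic_on_subset[OF holomorphic_zeta_ext])
           (auto simp: b_def)
      show "s \<in> {z. Re z > b} - {1}" using assms f by (auto simp: b_def)
      show "\<And>z. z \<in> {z. max b 1 < Re z} \<Longrightarrow> f z - zeta_ext z = 0"
        using f(3) zeta_ext_sums by (auto simp: b_def sums_iff)
    qed (auto intro: holomorphic_intros)
    thus "w = zeta_ext s" using f by simp
  qed
  thus ?thesis using assms by (simp add: zeta_def)
qed

section \<open>Mean squares of Dirichlet sums\<close>

lemma abs_integral_cos_le:
  fixes w T :: real
  assumes "w \<noteq> 0" "T \<ge> 1"
  shows "\<bar>integral {1..T} (\<lambda>t. cos (t * w))\<bar> \<le> 2 / \<bar>w\<bar>"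
proof -
  have "((\<lambda>t. cos (t * w)) has_integral (sin (T * w) / w - sin (1 * w) / w)) {1..T}"
    using assms by (intro fundamental_theorem_of_calculus)
      (auto intro!: derivative_eq_intros simp flip: has_real_derivative_iff_has_vector_derivative)
  hence "integral {1..T} (\<lambda>t. cos (t * w)) = (sin (T * w) - sin w) / w"
    by (simp add: integral_unique diff_divide_distrib)
  moreover have "\<bar>sin (T * w) - sin w\<bar> \<le> 2"
    using abs_sin_le_one[of "T * w"] abs_sin_le_one[of w] by linarith
  ultimately show ?thesis by (simp add: divide_right_mono)
qed

text \<open>With real coefficients the expanded square consists of cosines of frequency differences.
  The diagonal integrates to T - 1 per term, and every other pair is bounded independently of T.
  Estimating the pairs separately is affordable because the sums will be shorter than T.\<close>

lemma mean_square_exponential_sum: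
  fixes a \<theta> :: "nat \<Rightarrow> real"
  assumes "finite I" "inj_on \<theta> I" "T \<ge> 1" and a: "\<And>n. n \<in> I \<Longrightarrow> a n \<ge> 0"
  shows "\<bar>integral {1..T} (\<lambda>t. (cmod (\<Sum>n\<in>I. of_real (a n) * cis (- (t * \<theta> n))))\<^sup>2) - (T - 1) * (\<Sum>n\<in>I. (a n)\<^sup>2)\<bar>
     \<le> (\<Sum>m\<in>I. \<Sum>n\<in>I - {m}. 2 * a m * a n / \<bar>\<theta> m - \<theta> n\<bar>)"
proof -
  define J where "J = (\<lambda>m n. integral {1..T} (\<lambda>t. cos (t * (\<theta> m - \<theta> n))))"
  have eq: "(cmod (\<Sum>n\<in>I. of_real (a n) * cis (- (t * \<theta> n))))\<^sup>2
     = (\<Sum>m\<in>I. \<Sum>n\<in>I. a m * a n * cos (t * (\<theta> m - \<theta> n)))" for t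
    unfolding cmod_power2
    by (simp add: power2_eq_square sum_product sum.distrib[symmetric] cos_diff algebra_simps)
  have int: "(\<lambda>t. a m * a n * cos (t * (\<theta> m - \<theta> n))) integrable_on {1..T}" for m n
    by (intro integrable_continuous_interval continuous_intros)
  have "integral {1..T} (\<lambda>t. (cmod (\<Sum>n\<in>I. of_real (a n) * cis (- (t * \<theta> n))))\<^sup>2)
      = (\<Sum>m\<in>I. \<Sum>n\<in>I. a m * a n * J m n)"
    unfolding eq using assms(1) by (simp add: integral_sum int integrable_sum J_def)
  also have "\<dots> = (\<Sum>m\<in>I. (T - 1) * (a m)\<^sup>2 + (\<Sum>n\<in>I - {m}. a m * a n * J m n))"
    using assms(1,3) by (intro sum.cong refl) (simp add: sum.remove J_def power2_eq_square)
  finally have "\<bar>integral {1..T} (\<lambda>t. (cmod (\<Sum>n\<in>I. of_real (a n) * cis (- (t * \<theta> n))))\<^sup>2) - (T - 1) * (\<Sum>n\<in>I. (a n)\<^sup>2)\<bar>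
     = \<bar>\<Sum>m\<in>I. \<Sum>n\<in>I - {m}. a m * a n * J m n\<bar>"
    by (simp add: sum.distrib sum_distrib_left)
  also have "\<dots> \<le> (\<Sum>m\<in>I. \<Sum>n\<in>I - {m}. \<bar>a m * a n * J m n\<bar>)"
    by (intro order_trans[OF sum_abs] sum_mono sum_abs)
  also have "\<dots> \<le> (\<Sum>m\<in>I. \<Sum>n\<in>I - {m}. 2 * a m * a n / \<bar>\<theta> m - \<theta> n\<bar>)"
  proof (intro sum_mono)
    fix m n assume mn: "m \<in> I" "n \<in> I - {m}"
    hence "\<theta> m - \<theta> n \<noteq> 0" using assms(2) by (auto simp: inj_on_def)
    hence "\<bar>J m n\<bar> \<le> 2 / \<bar>\<theta> m - \<theta> n\<bar>" unfolding J_def by (rule abs_integral_cos_le[OF _ assms(3)])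
    hence "a m * a n * \<bar>J m n\<bar> \<le> a m * a n * (2 / \<bar>\<theta> m - \<theta> n\<bar>)"
      using mn by (intro mult_left_mono mult_nonneg_nonneg a) auto
    thus "\<bar>a m * a n * J m n\<bar> \<le> 2 * a m * a n / \<bar>\<theta> m - \<theta> n\<bar>"
      using mn a by (simp add: abs_mult mult_ac)
  qed
  finally show ?thesis .
qed

text \<open>The parameter \<eta> buys a summable power of n - m, so that the bound is uniform in the length of the sum.\<close>
lemma off_diagonal_term_le:
  fixes b \<eta> u :: real and m n :: nat
  assumes "0 < m" "m < n" "u \<ge> 0" "0 \<le> \<eta>" "\<eta> \<le> b"
  defines "x \<equiv> real m + u" and "y \<equiv> real n + u"
  shows "x powr (- b) * y powr (- b) / \<bar>ln x - ln y\<bar>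
    \<le> x powr (- b) * y powr (- b) + x powr (1 - 2 * b + \<eta>) * real (n - m) powr (- 1 - \<eta>)"
proof -
  define k where "k = real (n - m)"
  have k: "k \<ge> 1" "y - x = k" using assms by (auto simp: k_def)
  have xy: "0 < x" "x < y" "0 < y" using assms by auto
  have "ln (x / y) \<le> x / y - 1" using xy by (intro ln_le_minus_one) auto
  hence "ln y - ln x \<ge> k / y" using xy k by (simp add: ln_div field_simps)
  moreover have "k / y > 0" using xy k by simp
  ultimately have "1 / \<bar>ln x - ln y\<bar> \<le> 1 / (k / y)"
    using xy by (intro divide_left_mono mult_pos_pos) auto
  \<comment> \<open>Here y = x + k. The 1 leads to a product of two separate sums; only x / k feels
    how close the frequencies are.\<close>
  also have "\<dots> = 1 + x / k" using k by (simp add: field_simps)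
  finally have 1: "1 / \<bar>ln x - ln y\<bar> \<le> 1 + x / k" .
  \<comment> \<open>Since y exceeds both x and k, the factor y powr (-\<eta>) can be charged to the
    gap k and the rest of the decay to x.\<close>
  have "y powr (- b) = y powr (- (b - \<eta>)) * y powr (- \<eta>)" by (simp flip: powr_add)
  also have "\<dots> \<le> x powr (- (b - \<eta>)) * k powr (- \<eta>)"
    using xy k assms by (intro mult_mono powr_mono2') auto
  finally have 2: "y powr (- b) \<le> x powr (- (b - \<eta>)) * k powr (- \<eta>)" .
  have "x powr (- b) * y powr (- b) / \<bar>ln x - ln y\<bar> \<le> x powr (- b) * y powr (- b) * (1 + x / k)"
    using mult_left_mono[OF 1, of "x powr (- b) * y powr (- b)"] by simp
  also have "\<dots> = x powr (- b) * y powr (- b) + x powr (- b) * (x / k) * y powr (- b)"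
    by (simp add: algebra_simps)
  also have "x powr (- b) * (x / k) * y powr (- b) \<le> x powr (- b) * (x / k) * (x powr (- (b - \<eta>)) * k powr (- \<eta>))"
    using xy k by (intro mult_left_mono 2) auto
  also have "\<dots> = (x powr 1 * x powr (- b) * x powr (- (b - \<eta>))) * (k powr (-1) * k powr (- \<eta>))"
    using xy k by (simp add: powr_minus divide_inverse mult_ac)
  also have "\<dots> = x powr (1 - 2 * b + \<eta>) * k powr (- 1 - \<eta>)"
    unfolding powr_add[symmetric] by (simp add: algebra_simps)
  finally show ?thesis by (simp add: k_def)
qed

lemma off_diagonal_sum_le:
  fixes b \<eta> u :: real and I :: "nat set"
  assumes "finite I" "\<And>n. n \<in> I \<Longrightarrow> 0 < n" "u \<ge> 0" "0 < \<eta>" "\<eta> \<le> b"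
  defines "x \<equiv> \<lambda>n. real n + u" and "Z \<equiv> \<Sum>k. real k powr (- 1 - \<eta>)"
  shows "(\<Sum>m\<in>I. \<Sum>n\<in>I - {m}. 2 * x m powr (- b) * x n powr (- b) / \<bar>ln (x m) - ln (x n)\<bar>)
    \<le> 2 * (\<Sum>n\<in>I. x n powr (- b))\<^sup>2 + 4 * Z * (\<Sum>n\<in>I. x n powr (1 - 2 * b + \<eta>))"
proof -
  \<comment> \<open>The gap term is charged to the smaller index. Of \<open>h m n\<close> and
    \<open>h n m\<close> at most one is nonzero, so their sum is a symmetric bound for the
    pair.\<close>
  define h where "h = (\<lambda>m n. if m < n then x m powr (1 - 2 * b + \<eta>) * real (n - m) powr (- 1 - \<eta>) else 0)"
  have h0: "h m n \<ge> 0" for m n by (simp add: h_def)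
  have pair: "x m powr (- b) * x n powr (- b) / \<bar>ln (x m) - ln (x n)\<bar>
     \<le> x m powr (- b) * x n powr (- b) + h m n + h n m" if "m \<in> I" "n \<in> I" "n \<noteq> m" for m n
  proof (cases "m < n")
    case True
    thus ?thesis using off_diagonal_term_le[of m n u \<eta> b] assms that by (simp add: h_def)
  next
    case False
    thus ?thesis using off_diagonal_term_le[of n m u \<eta> b] assms that
      by (simp add: h_def mult.commute abs_minus_commute)
  qed
  have Zs: "summable (\<lambda>k. real k powr (- 1 - \<eta>))" using assms by (simp add: summable_real_powr_iff)
  have hsum: "(\<Sum>n\<in>I. h m n) \<le> x m powr (1 - 2 * b + \<eta>) * Z" for m
  proof -
    have "(\<Sum>n\<in>I. h m n) = x m powr (1 - 2 * b + \<eta>) * (\<Sum>n\<in>{n\<in>I. m < n}. real (n - m) powr (- 1 - \<eta>))"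
      using assms(1) by (simp add: h_def sum.inter_filter[symmetric] sum_distrib_left if_distrib cong: if_cong)
    \<comment> \<open>For fixed m distinct n give distinct gaps, so the gaps are summed at most once
      each and \<open>Z\<close> bounds the result.\<close>
    also have "(\<Sum>n\<in>{n\<in>I. m < n}. real (n - m) powr (- 1 - \<eta>)) = (\<Sum>k\<in>(\<lambda>n. n - m) ` {n\<in>I. m < n}. real k powr (- 1 - \<eta>))"
      by (subst sum.reindex) (auto simp: inj_on_def)
    also have "\<dots> \<le> Z" unfolding Z_def using assms(1) by (intro sum_le_suminf Zs) auto
    finally show ?thesis by (simp add: mult_left_mono)
  qed
  have "(\<Sum>m\<in>I. \<Sum>n\<in>I - {m}. 2 * x m powr (- b) * x n powr (- b) / \<bar>ln (x m) - ln (x n)\<bar>)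
     \<le> (\<Sum>m\<in>I. \<Sum>n\<in>I - {m}. 2 * (x m powr (- b) * x n powr (- b) + h m n + h n m))"
    using pair by (intro sum_mono) (force simp: mult.assoc)
  \<comment> \<open>Restoring the nonnegative diagonal completes the first part to a perfect
    square.\<close>
  also have "\<dots> \<le> (\<Sum>m\<in>I. \<Sum>n\<in>I. 2 * (x m powr (- b) * x n powr (- b) + h m n + h n m))"
    using h0 assms(1) by (intro sum_mono sum_mono2) auto
  also have "\<dots> = 2 * (\<Sum>n\<in>I. x n powr (- b))\<^sup>2 + 2 * (\<Sum>m\<in>I. \<Sum>n\<in>I. h m n) + 2 * (\<Sum>m\<in>I. \<Sum>n\<in>I. h n m)"
    by (simp add: power2_eq_square sum_product sum.distrib sum_distrib_left algebra_simps)
  also have "(\<Sum>m\<in>I. \<Sum>n\<in>I. h n m) = (\<Sum>m\<in>I. \<Sum>n\<in>I. h m n)" by (rule sum.swap)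
  also have "(\<Sum>m\<in>I. \<Sum>n\<in>I. h m n) \<le> (\<Sum>m\<in>I. x m powr (1 - 2 * b + \<eta>) * Z)"
    by (intro sum_mono hsum)
  finally show ?thesis by (simp add: sum_distrib_left sum_distrib_right mult_ac)
qed

lemma of_real_powr_Complex:
  assumes "x > 0"
  shows "complex_of_real x powr Complex b t = of_real (x powr b) * cis (t * ln x)"
proof -
  have "Complex b t * of_real (ln x) = Complex (b * ln x) (t * ln x)" by (simp add: complex_eq_iff)
  thus ?thesis using assms by (simp add: powr_def Ln_of_real exp_eq_polar mult.commute)
qed

text \<open>The shift u allows a double use: u = 0 is the Dirichlet sum itself, while u in [0, 1]
  with b = \<sigma> + 1 is the integrand of the remainder.\<close>

lemma mean_square_shifted_dirichlet_sum:
  fixes b \<eta> u T :: real and I :: "nat set"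
  assumes "finite I" "\<And>n. n \<in> I \<Longrightarrow> 0 < n" "u \<ge> 0" "0 < \<eta>" "\<eta> \<le> b" "T \<ge> 1"
  shows "\<bar>integral {1..T} (\<lambda>t. (cmod (\<Sum>n\<in>I. of_real (real n + u) powr (- Complex b t)))\<^sup>2)
       - (T - 1) * (\<Sum>n\<in>I. (real n + u) powr (- 2 * b))\<bar>
    \<le> 2 * (\<Sum>n\<in>I. (real n + u) powr (- b))\<^sup>2
      + 4 * (\<Sum>k. real k powr (- 1 - \<eta>)) * (\<Sum>n\<in>I. (real n + u) powr (1 - 2 * b + \<eta>))"
proof -
  have pos: "real n + u > 0" if "n \<in> I" for n using assms(2)[OF that] assms(3) by simp
  have "inj_on (\<lambda>n. ln (real n + u)) I" using pos by (auto simp: inj_on_def)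
  from mean_square_exponential_sum[OF assms(1) this assms(6), of "\<lambda>n. (real n + u) powr (- b)", OF powr_ge_zero]
    off_diagonal_sum_le[OF assms(1-5)]
  have *: "\<bar>integral {1..T} (\<lambda>t. (cmod (\<Sum>n\<in>I. of_real ((real n + u) powr (- b)) * cis (- (t * ln (real n + u)))))\<^sup>2)
       - (T - 1) * (\<Sum>n\<in>I. ((real n + u) powr (- b))\<^sup>2)\<bar>
    \<le> 2 * (\<Sum>n\<in>I. (real n + u) powr (- b))\<^sup>2
      + 4 * (\<Sum>k. real k powr (- 1 - \<eta>)) * (\<Sum>n\<in>I. (real n + u) powr (1 - 2 * b + \<eta>))"
    by (rule order_trans)
  have "(\<Sum>n\<in>I. of_real ((real n + u) powr (- b)) * cis (- (t * ln (real n + u))))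
     = (\<Sum>n\<in>I. of_real (real n + u) powr (- Complex b t))" for t
  proof (intro sum.cong refl)
    fix n assume "n \<in> I"
    have "- Complex b t = Complex (-b) (-t)" by (simp add: complex_eq_iff)
    thus "of_real ((real n + u) powr (- b)) * cis (- (t * ln (real n + u))) = of_real (real n + u) powr (- Complex b t)"
      using of_real_powr_Complex[OF pos[OF \<open>n \<in> I\<close>], of "-b" "-t"] by simp
  qed
  moreover have "((real n + u) powr (- b))\<^sup>2 = (real n + u) powr (- 2 * b)" for n
    by (simp add: power2_eq_square flip: powr_add)
  ultimately show ?thesis using * by simp
qed

section \<open>Mean square of the remainder integral\<close>

text \<open>Comparison with the telescoping differences of n powr (-p). The intermediate point of
  the mean value theorem lies below n + 1 \<le> 2 * n, and this doubling costs the factor 2 powr (1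
  + p).\<close>

lemma sum_powr_tail_le:
  fixes p :: real
  assumes "p > 0" "0 < N"
  shows "(\<Sum>n\<in>{N..<M}. real n powr (- 1 - p)) \<le> 2 powr (1 + p) / p * real N powr (- p)"
proof -
  have step: "real n powr (- 1 - p) \<le> 2 powr (1 + p) / p * (real n powr (- p) - real (Suc n) powr (- p))" if "0 < n" for n
  proof -
    have "\<exists>z. real n < z \<and> z < real n + 1 \<and>
      (real n + 1) powr (- p) - real n powr (- p) = (real n + 1 - real n) * (- p * z powr (- p - 1))"
      using that by (intro MVT2 has_real_derivative_powr) auto
    then obtain z where z: "real n < z" "z < real n + 1"
      "(real n + 1) powr (- p) - real n powr (- p) = (real n + 1 - real n) * (- p * z powr (- p - 1))"
      by blast
    have "real n powr (- 1 - p) = 2 powr (1 + p) * (2 * real n) powr (- p - 1)"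
      using that by (simp add: powr_mult powr_diff powr_add powr_minus field_simps)
    also have "(2 * real n) powr (- p - 1) \<le> z powr (- p - 1)"
      using z that assms by (intro powr_mono2') auto
    also have "2 powr (1 + p) * z powr (- p - 1) = 2 powr (1 + p) / p * (real n powr (- p) - real (Suc n) powr (- p))"
    proof -
      have "real n powr (- p) - real (Suc n) powr (- p) = p * z powr (- p - 1)"
        using z(3) by (simp add: add.commute)
      thus ?thesis using assms by simp
    qed
    finally show ?thesis by simp
  qed
  show ?thesis
  proof (cases "N \<le> M")
    case True
    have "(\<Sum>n\<in>{N..<M}. real n powr (- 1 - p)) \<le> (\<Sum>n\<in>{N..<M}. 2 powr (1 + p) / p * (real n powr (- p) - real (Suc n) powr (- p)))"
      using assms by (intro sum_mono step) auto
    also have "\<dots> = 2 powr (1 + p) / p * (real N powr (- p) - real M powr (- p))"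
      unfolding sum_distrib_left[symmetric]
      using sum_Suc_diff'[OF True, of "\<lambda>n. - (real n powr (- p))"] by simp
    also have "\<dots> \<le> 2 powr (1 + p) / p * real N powr (- p)"
      using assms by (intro mult_left_mono) auto
    finally show ?thesis .
  qed (use assms in auto)
qed

text \<open>The variance of f on an interval of length 1 is nonnegative; this is Cauchy-Schwarz
  against the constant 1.\<close>

lemma square_integral_le:
  fixes f :: "real \<Rightarrow> real"
  assumes "continuous_on {0..1} f"
  shows "(integral {0..1} f)\<^sup>2 \<le> integral {0..1} (\<lambda>u. (f u)\<^sup>2)"
proof -
  define J where "J = integral {0..1} f"
  have [simp]: "f integrable_on {0..1}" "(\<lambda>u. (f u)\<^sup>2) integrable_on {0..1}"
    using assms by (intro integrable_continuous_interval continuous_intros; simp)+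
  have "0 \<le> integral {0..1} (\<lambda>u. (f u - J)\<^sup>2)"
    using assms by (intro integral_nonneg integrable_continuous_interval continuous_intros) auto
  also have "(\<lambda>u. (f u - J)\<^sup>2) = (\<lambda>u. (f u)\<^sup>2 - (2 * J * f u - J\<^sup>2))"
    by (simp add: power2_eq_square algebra_simps)
  also have "integral {0..1} \<dots> = integral {0..1} (\<lambda>u. (f u)\<^sup>2) - (2 * J * J - J\<^sup>2)"
  proof (rule integral_unique, intro has_integral_diff has_integral_mult_right)
    show "((\<lambda>u::real. J\<^sup>2) has_integral J\<^sup>2) {0..1}"
      using has_integral_const_real[of "J\<^sup>2" 0 1] by simp
  qed (simp_all add: J_def integrable_integral)
  finally show ?thesis by (simp add: J_def power2_eq_square)
qed

lemma continuous_on_frac_term: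
  assumes "0 < n"
  shows "continuous_on A (\<lambda>t. frac_term n (Complex \<sigma> t))"
proof -
  have "continuous_on (A \<times> cbox 0 1) (\<lambda>(t, u). of_real u * complex_of_real (real n + u) powr (- Complex \<sigma> t - 1))"
    unfolding case_prod_unfold Complex_eq using assms
    by (intro continuous_intros) (force simp: complex_nonpos_Reals_iff complex_eq_iff)+
  from integral_continuous_on_param[OF this] show ?thesis by (simp add: frac_term_def)
qed

lemma continuous_on_frac_term_suminf:
  assumes "\<sigma> > 0" "0 < N"
  shows "continuous_on A (\<lambda>t. \<Sum>k. frac_term (k + N) (Complex \<sigma> t))"
proof (rule uniform_limit_theorem[where F = sequentially])
  show "uniform_limit A (\<lambda>M t. \<Sum>k<M. frac_term (k + N) (Complex \<sigma> t))
      (\<lambda>t. \<Sum>k. frac_term (k + N) (Complex \<sigma> t)) sequentially"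
  proof (rule Weierstrass_m_test)
    show "norm (frac_term (k + N) (Complex \<sigma> t)) \<le> real (k + N) powr (- \<sigma> - 1)" for k t
      using cmod_frac_term_le[of "k + N" "Complex \<sigma> t"] assms by simp
    show "summable (\<lambda>k. real (k + N) powr (- \<sigma> - 1))"
      using assms by (subst summable_iff_shift) (simp add: summable_real_powr_iff)
  qed
qed (use assms in \<open>auto intro!: always_eventually continuous_intros continuous_on_frac_term\<close>)

lemma mean_square_frac_term_sum:
  fixes \<sigma> \<eta> T :: real and I :: "nat set"
  assumes "finite I" "\<And>n. n \<in> I \<Longrightarrow> 0 < n" "0 < \<eta>" "\<eta> \<le> \<sigma>" "T \<ge> 1"
  shows "integral {1..T} (\<lambda>t. (cmod (\<Sum>n\<in>I. frac_term n (Complex \<sigma> t)))\<^sup>2)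
    \<le> T * (\<Sum>n\<in>I. real n powr (- 2 * (\<sigma> + 1))) + 2 * (\<Sum>n\<in>I. real n powr (- (\<sigma> + 1)))\<^sup>2
      + 4 * (\<Sum>k. real k powr (- 1 - \<eta>)) * (\<Sum>n\<in>I. real n powr (1 - 2 * (\<sigma> + 1) + \<eta>))" (is "_ \<le> ?B")
proof -
  define P where "P = (\<lambda>t u. \<Sum>n\<in>I. complex_of_real (real n + u) powr (- Complex (\<sigma> + 1) t))"
  have cont: "continuous_on (cbox (1, 0) (T, 1)) (\<lambda>(t, u). (cmod (P t u))\<^sup>2)"
    unfolding P_def case_prod_unfold Complex_eq using assms(1,2)
    by (intro continuous_intros) (force simp: complex_nonpos_Reals_iff complex_eq_iff cbox_Pair_eq)+
  have contu: "continuous_on {0..1} (\<lambda>u. P t u)" for t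
    unfolding P_def using assms(1,2) by (intro continuous_intros continuous_on_shift_powr) (auto simp: Suc_le_eq)
  have exponent: "- Complex \<sigma> t - 1 = - Complex (\<sigma> + 1) t" for t by (simp add: complex_eq_iff)
  have frac: "(\<Sum>n\<in>I. frac_term n (Complex \<sigma> t)) = integral {0..1} (\<lambda>u. of_real u * P t u)" for t
  proof -
    have "(\<Sum>n\<in>I. frac_term n (Complex \<sigma> t)) =
       integral {0..1} (\<lambda>u. \<Sum>n\<in>I. of_real u * complex_of_real (real n + u) powr (- Complex (\<sigma> + 1) t))"
      unfolding frac_term_def exponent using assms(1,2)
      by (subst integral_sum)
         (auto intro!: integrable_continuous_interval continuous_intros continuous_on_shift_powr simp: Suc_le_eq simp del: of_real_add)
    thus ?thesis by (simp add: P_def sum_distrib_left)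
  qed
  have pointwise: "(cmod (\<Sum>n\<in>I. frac_term n (Complex \<sigma> t)))\<^sup>2 \<le> integral {0..1} (\<lambda>u. (cmod (P t u))\<^sup>2)" for t
  proof -
    \<comment> \<open>The weight u is at most 1 and is dropped.\<close>
    have "cmod (integral {0..1} (\<lambda>u. of_real u * P t u)) \<le> integral {0..1} (\<lambda>u. cmod (P t u))"
      using contu by (intro integral_norm_bound_integral integrable_continuous_interval continuous_intros)
        (auto simp: norm_mult mult_left_le_one_le)
    hence "(cmod (\<Sum>n\<in>I. frac_term n (Complex \<sigma> t)))\<^sup>2 \<le> (integral {0..1} (\<lambda>u. cmod (P t u)))\<^sup>2"
      unfolding frac by (intro power_mono) auto
    also have "\<dots> \<le> integral {0..1} (\<lambda>u. (cmod (P t u))\<^sup>2)"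
      by (intro square_integral_le continuous_intros contu)
    finally show ?thesis .
  qed
  have contF: "continuous_on {1..T} (\<lambda>t. integral {0..1} (\<lambda>u. (cmod (P t u))\<^sup>2))"
    using integral_continuous_on_param[of "{1..T}" 0 1 "\<lambda>t u. (cmod (P t u))\<^sup>2"] cont
    by (simp add: cbox_Pair_eq)
  have contS: "continuous_on {1..T} (\<lambda>t. \<Sum>n\<in>I. frac_term n (Complex \<sigma> t))"
    using assms(2) by (intro continuous_intros continuous_on_frac_term)
  have "integral {1..T} (\<lambda>t. (cmod (\<Sum>n\<in>I. frac_term n (Complex \<sigma> t)))\<^sup>2)
     \<le> integral {1..T} (\<lambda>t. integral {0..1} (\<lambda>u. (cmod (P t u))\<^sup>2))"
    by (intro integral_le integrable_continuous_interval continuous_intros contS contF pointwise)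
  \<comment> \<open>After the swap u is fixed inside, so the mean value estimate in t applies to a
    genuine exponential sum.\<close>
  also have "\<dots> = integral {0..1} (\<lambda>u. integral {1..T} (\<lambda>t. (cmod (P t u))\<^sup>2))"
    using integral_swap_continuous[OF cont] by simp
  also have "\<dots> \<le> integral {0..1} (\<lambda>u::real. ?B)"
  proof (rule integral_le)
    have "continuous_on (cbox (0, 1) (1, T)) (\<lambda>(u, t). (cmod (P t u))\<^sup>2)"
      unfolding P_def case_prod_unfold Complex_eq using assms(1,2)
      by (intro continuous_intros) (force simp: complex_nonpos_Reals_iff complex_eq_iff cbox_Pair_eq)+
    hence "continuous_on {0..1} (\<lambda>u. integral {1..T} (\<lambda>t. (cmod (P t u))\<^sup>2))"
      using integral_continuous_on_param[of "{0..1}" 1 T "\<lambda>u t. (cmod (P t u))\<^sup>2"] by (simp add: cbox_Pair_eq)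
    thus "(\<lambda>u. integral {1..T} (\<lambda>t. (cmod (P t u))\<^sup>2)) integrable_on {0..1}"
      by (rule integrable_continuous_interval)
    fix u :: real assume u: "u \<in> {0..1}"
    \<comment> \<open>All exponents that occur are negative, the last one because \<eta> \<le>
      \<sigma>, so u = 0 is the worst case and the bound becomes free of u.\<close>
    have mono: "(\<Sum>n\<in>I. (real n + u) powr e) \<le> (\<Sum>n\<in>I. real n powr e)" if "e \<le> 0" for e
      using that u assms(2) by (intro sum_mono powr_mono2') force+
    have "integral {1..T} (\<lambda>t. (cmod (P t u))\<^sup>2) \<le> (T - 1) * (\<Sum>n\<in>I. (real n + u) powr (- 2 * (\<sigma> + 1)))
       + (2 * (\<Sum>n\<in>I. (real n + u) powr (- (\<sigma> + 1)))\<^sup>2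
      + 4 * (\<Sum>k. real k powr (- 1 - \<eta>)) * (\<Sum>n\<in>I. (real n + u) powr (1 - 2 * (\<sigma> + 1) + \<eta>)))"
      using mean_square_shifted_dirichlet_sum[of I u \<eta> "\<sigma> + 1" T] u assms unfolding P_def by simp
    also have "\<dots> \<le> T * (\<Sum>n\<in>I. real n powr (- 2 * (\<sigma> + 1))) + (2 * (\<Sum>n\<in>I. real n powr (- (\<sigma> + 1)))\<^sup>2
      + 4 * (\<Sum>k. real k powr (- 1 - \<eta>)) * (\<Sum>n\<in>I. real n powr (1 - 2 * (\<sigma> + 1) + \<eta>)))"
      using assms by (intro add_mono mult_mono mono power_mono sum_nonneg mult_nonneg_nonneg suminf_nonneg)
        (auto simp: summable_real_powr_iff)
    finally show "integral {1..T} (\<lambda>t. (cmod (P t u))\<^sup>2) \<le> ?B" by simp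
  qed auto
  finally show ?thesis by simp
qed

text \<open>The constant has to be uniform in N, because N will grow with T. Finite blocks satisfy
  the bound independently of their length, and dominated convergence carries it to the infinite
  tail.\<close>

lemma mean_square_frac_term_suminf:
  fixes \<sigma> \<eta> :: real
  assumes "0 < \<eta>" "\<eta> \<le> \<sigma>"
  obtains C where "C \<ge> 0" "\<And>N T. N \<ge> 1 \<Longrightarrow> T \<ge> 1 \<Longrightarrow>
    integral {1..T} (\<lambda>t. (cmod (\<Sum>k. frac_term (k + N) (Complex \<sigma> t)))\<^sup>2)
    \<le> C * (T * real N powr (- (2 * \<sigma> + 1)) + real N powr (- (2 * \<sigma> - \<eta>)))"
proof -
  define K where "K = (\<lambda>p::real. 2 powr (1 + p) / p)"
  define Z where "Z = (\<Sum>k. real k powr (- 1 - \<eta>))"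
  define C where "C = K (2 * \<sigma> + 1) + 2 * (K \<sigma>)\<^sup>2 + 4 * Z * K (2 * \<sigma> - \<eta>)"
  have pos: "\<sigma> > 0" "2 * \<sigma> - \<eta> > 0" using assms by auto
  have Z: "Z \<ge> 0" unfolding Z_def using assms by (intro suminf_nonneg) (auto simp: summable_real_powr_iff)
  have K: "K p \<ge> 0" if "p > 0" for p using that by (simp add: K_def)
  have C: "C \<ge> 0" using Z K[of "2 * \<sigma> + 1"] K[of "2 * \<sigma> - \<eta>"] pos by (simp add: C_def)
  show ?thesis
  proof (rule that[OF C])
    fix N :: nat and T :: real assume N: "N \<ge> 1" and T: "T \<ge> 1"
    define B where "B = C * (T * real N powr (- (2 * \<sigma> + 1)) + real N powr (- (2 * \<sigma> - \<eta>)))"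
    define f where "f = (\<lambda>M t. (cmod (\<Sum>k<M. frac_term (k + N) (Complex \<sigma> t)))\<^sup>2)"
    have reindex: "(\<Sum>k<M. frac_term (k + N) z) = (\<Sum>n\<in>{N..<N+M}. frac_term n z)" for M z
      by (rule sum.reindex_bij_witness[of _ "\<lambda>n. n - N" "\<lambda>k. k + N"]) auto
    have finite_part: "integral {1..T} (f M) \<le> B" for M
    proof -
      \<comment> \<open>Applied with p = 2 * \<sigma> + 1, p = \<sigma> and p = 2 * \<sigma> -
        \<eta>.\<close>
      have tail: "(\<Sum>n\<in>{N..<N+M}. real n powr (- 1 - p)) \<le> K p * real N powr (- p)" if "p > 0" for p
        unfolding K_def using that N by (intro sum_powr_tail_le) auto
      have 1: "(\<Sum>n\<in>{N..<N+M}. real n powr (- 2 * (\<sigma> + 1))) \<le> K (2 * \<sigma> + 1) * real N powr (- (2 * \<sigma> + 1))"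
        using tail[of "2 * \<sigma> + 1"] pos by (simp add: algebra_simps)
      have 2: "(\<Sum>n\<in>{N..<N+M}. real n powr (- (\<sigma> + 1)))\<^sup>2 \<le> (K \<sigma>)\<^sup>2 * real N powr (- (2 * \<sigma> - \<eta>))"
      proof -
        have "(\<Sum>n\<in>{N..<N+M}. real n powr (- (\<sigma> + 1)))\<^sup>2 \<le> (K \<sigma> * real N powr (- \<sigma>))\<^sup>2"
          using tail[of \<sigma>] pos by (intro power_mono sum_nonneg) (auto simp: algebra_simps)
        also have "\<dots> = (K \<sigma>)\<^sup>2 * real N powr (- (2 * \<sigma>))"
          by (simp add: power_mult_distrib power2_eq_square flip: powr_add)
        \<comment> \<open>The exponent is weakened by \<eta> only to merge this term with the third
          one.\<close>
        also have "\<dots> \<le> (K \<sigma>)\<^sup>2 * real N powr (- (2 * \<sigma> - \<eta>))"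
          using N assms by (intro mult_left_mono powr_mono) auto
        finally show ?thesis .
      qed
      have 3: "(\<Sum>n\<in>{N..<N+M}. real n powr (1 - 2 * (\<sigma> + 1) + \<eta>)) \<le> K (2 * \<sigma> - \<eta>) * real N powr (- (2 * \<sigma> - \<eta>))"
        using tail[of "2 * \<sigma> - \<eta>"] pos by (simp add: algebra_simps)
      have "integral {1..T} (f M) \<le> T * (K (2 * \<sigma> + 1) * real N powr (- (2 * \<sigma> + 1)))
          + 2 * ((K \<sigma>)\<^sup>2 * real N powr (- (2 * \<sigma> - \<eta>))) + 4 * Z * (K (2 * \<sigma> - \<eta>) * real N powr (- (2 * \<sigma> - \<eta>)))"
        unfolding f_def reindex Z_def
        by (rule order_trans[OF mean_square_frac_term_sum[of _ \<eta>]], simp, use N assms T in force,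
            fact, fact, fact, intro add_mono mult_left_mono 1 2 3)
           (use T Z in \<open>auto simp: Z_def\<close>)
      also have "\<dots> \<le> B"
        unfolding B_def C_def using T Z K[of "2 * \<sigma> + 1"] K[of "2 * \<sigma> - \<eta>"] pos
        by (simp add: algebra_simps add_nonneg_nonneg)
      finally show ?thesis .
    qed
    have contf: "continuous_on {1..T} (\<lambda>t. \<Sum>k<M. frac_term (k + N) (Complex \<sigma> t))" for M
      using N by (intro continuous_intros continuous_on_frac_term) auto
    \<comment> \<open>The termwise bound does not involve t, so its sum gives a constant majorant
      for all partial sums.\<close>
    define S where "S = (\<Sum>k. real (k + N) powr (- \<sigma> - 1))"
    have summ: "summable (\<lambda>k. real (k + N) powr (- \<sigma> - 1))"
      using pos by (subst summable_iff_shift) (simp add: summable_real_powr_iff)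
    have "(\<lambda>M. integral {1..T} (f M)) \<longlonglongrightarrow> integral {1..T} (\<lambda>t. (cmod (\<Sum>k. frac_term (k + N) (Complex \<sigma> t)))\<^sup>2)"
    proof (rule dominated_convergence)
      show "f M integrable_on {1..T}" for M
        unfolding f_def by (intro integrable_continuous_interval continuous_intros contf)
      show "(\<lambda>_. S\<^sup>2) integrable_on {1..T}" by (intro integrable_continuous_interval continuous_intros)
      fix t :: real assume "t \<in> {1..T}"
      show "norm (f M t) \<le> S\<^sup>2" for M
      proof -
        have "cmod (\<Sum>k<M. frac_term (k + N) (Complex \<sigma> t)) \<le> (\<Sum>k<M. real (k + N) powr (- \<sigma> - 1))"
          using N pos cmod_frac_term_le[of "_ + N" "Complex \<sigma> t"] by (intro sum_norm_le) auto
        also have "\<dots> \<le> S" unfolding S_def by (intro sum_le_suminf summ) auto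
        finally show ?thesis unfolding f_def by (simp add: power_mono)
      qed
      show "(\<lambda>M. f M t) \<longlonglongrightarrow> (cmod (\<Sum>k. frac_term (k + N) (Complex \<sigma> t)))\<^sup>2"
        using summable_LIMSEQ[OF summable_frac_term[of "Complex \<sigma> t" "N - 1"]] N pos
        unfolding f_def by (intro tendsto_intros) simp
    qed
    thus "integral {1..T} (\<lambda>t. (cmod (\<Sum>k. frac_term (k + N) (Complex \<sigma> t)))\<^sup>2)
       \<le> C * (T * real N powr (- (2 * \<sigma> + 1)) + real N powr (- (2 * \<sigma> - \<eta>)))"
      using finite_part unfolding B_def by (intro LIMSEQ_le_const2) auto
  qed
qed

section \<open>Perturbation of mean squares\<close>

text \<open>The cross term is split by the arithmetic-geometric mean inequality with a free weight
  d. Integrated, this avoids a Cauchy-Schwarz inequality over [1, T], at the price of choosing d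
  afterwards.\<close>

lemma cmod_add_square_diff_le:
  fixes a b :: complex
  assumes "d > 0"
  shows "\<bar>(cmod (a + b))\<^sup>2 - (cmod a)\<^sup>2\<bar> \<le> d * (cmod a)\<^sup>2 + (1 + 1 / d) * (cmod b)\<^sup>2"
proof -
  define p q where "p = cmod a" and "q = cmod b"
  have pq: "p \<ge> 0" "q \<ge> 0" by (auto simp: p_def q_def)
  have "0 \<le> (d * p - q)\<^sup>2 / d" using assms by simp
  also have "(d * p - q)\<^sup>2 / d = d * p\<^sup>2 + (1 / d) * q\<^sup>2 - 2 * p * q"
    using assms by (simp add: power2_eq_square field_simps)
  finally have 1: "2 * p * q \<le> d * p\<^sup>2 + (1 / d) * q\<^sup>2" by simp
  have "cmod (a + b) \<le> p + q" unfolding p_def q_def by (rule norm_triangle_ineq)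
  hence 2: "(cmod (a + b))\<^sup>2 \<le> (p + q)\<^sup>2" by (intro power_mono) auto
  have 3: "\<bar>p - q\<bar> \<le> cmod (a + b)" unfolding p_def q_def
    using norm_triangle_ineq3[of a "- b"] by simp
  have "(p - q)\<^sup>2 \<le> (cmod (a + b))\<^sup>2"
    using power_mono[OF 3, of 2] by simp
  moreover have "q\<^sup>2 \<ge> 0" by simp
  ultimately have "\<bar>(cmod (a + b))\<^sup>2 - p\<^sup>2\<bar> \<le> 2 * p * q + q\<^sup>2"
    using 2 unfolding power2_sum power2_diff by linarith
  also have "\<dots> \<le> d * p\<^sup>2 + (1 + 1 / d) * q\<^sup>2" using 1 by (simp add: algebra_simps)
  finally show ?thesis by (simp add: p_def q_def)
qed

text \<open>Both functions carry the parameter T besides t, since the length of the approximating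
  sum changes with the range of integration.\<close>

lemma mean_square_perturb:
  fixes f g :: "real \<Rightarrow> real \<Rightarrow> complex"
  assumes cont: "\<And>T. continuous_on {1..T} (f T)" "\<And>T. continuous_on {1..T} (g T)"
    and f: "((\<lambda>T. integral {1..T} (\<lambda>t. (cmod (f T t))\<^sup>2) / T) \<longlongrightarrow> L) at_top"
    and g: "((\<lambda>T. integral {1..T} (\<lambda>t. (cmod (g T t))\<^sup>2) / T) \<longlongrightarrow> 0) at_top"
  shows "((\<lambda>T. integral {1..T} (\<lambda>t. (cmod (f T t + g T t))\<^sup>2) / T) \<longlongrightarrow> L) at_top"
proof -
  define F where "F = (\<lambda>T. integral {1..T} (\<lambda>t. (cmod (f T t))\<^sup>2) / T)"
  define G where "G = (\<lambda>T. integral {1..T} (\<lambda>t. (cmod (g T t))\<^sup>2) / T)"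
  define H where "H = (\<lambda>T. integral {1..T} (\<lambda>t. (cmod (f T t + g T t))\<^sup>2) / T)"
  \<comment> \<open>The weight d tends to 0, but slowly enough for G / d to vanish; 1 / T keeps it positive.\<close>
  define d where "d = (\<lambda>T. sqrt (G T) + 1 / T)"
  have G: "(G \<longlongrightarrow> 0) at_top" and F: "(F \<longlongrightarrow> L) at_top" using f g by (simp_all add: F_def G_def)
  have inv: "((\<lambda>T::real. 1 / T) \<longlongrightarrow> 0) at_top"
    by (intro tendsto_divide_0[OF tendsto_const] filterlim_at_top_imp_at_infinity filterlim_ident)
  have sq: "((\<lambda>T. sqrt (G T)) \<longlongrightarrow> 0) at_top" using tendsto_real_sqrt[OF G] by simp
  have "((\<lambda>T. H T - F T) \<longlongrightarrow> 0) at_top"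
  proof (rule Lim_null_comparison)
    have "((\<lambda>T. d T * F T + G T + sqrt (G T)) \<longlongrightarrow> (0 + 0) * L + 0 + 0) at_top"
      unfolding d_def by (intro tendsto_intros F G sq inv)
    thus "((\<lambda>T. d T * F T + G T + sqrt (G T)) \<longlongrightarrow> 0) at_top" by simp
    show "\<forall>\<^sub>F T in at_top. norm (H T - F T) \<le> d T * F T + G T + sqrt (G T)"
      using eventually_ge_at_top[of 1]
    proof eventually_elim
      case (elim T)
      have G0: "G T \<ge> 0" unfolding G_def using elim cont
        by (intro divide_nonneg_nonneg integral_nonneg integrable_continuous_interval continuous_intros) auto
      have dpos: "d T > 0" unfolding d_def using elim G0 by (intro add_nonneg_pos) auto
      let ?f = "\<lambda>t. (cmod (f T t))\<^sup>2" and ?g = "\<lambda>t. (cmod (g T t))\<^sup>2" and ?h = "\<lambda>t. (cmod (f T t + g T t))\<^sup>2"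
      have int: "?f integrable_on {1..T}" "?g integrable_on {1..T}" "?h integrable_on {1..T}"
        by (intro integrable_continuous_interval continuous_intros cont)+
      have "\<bar>integral {1..T} (\<lambda>t. ?h t - ?f t)\<bar> \<le> integral {1..T} (\<lambda>t. d T * ?f t + (1 + 1 / d T) * ?g t)"
        using integral_norm_bound_integral[of "\<lambda>t. ?h t - ?f t" "{1..T}" "\<lambda>t. d T * ?f t + (1 + 1 / d T) * ?g t"]
          cmod_add_square_diff_le[OF dpos] int
        by (simp add: integrable_diff integrable_add integrable_on_mult_right)
      also have "\<dots> = d T * integral {1..T} ?f + (1 + 1 / d T) * integral {1..T} ?g"
        by (subst integral_add) (simp_all add: int integrable_on_mult_right)
      also have "integral {1..T} (\<lambda>t. ?h t - ?f t) = integral {1..T} ?h - integral {1..T} ?f"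
        by (intro integral_diff int)
      finally have "\<bar>integral {1..T} ?h - integral {1..T} ?f\<bar> / T \<le>
          (d T * integral {1..T} ?f + (1 + 1 / d T) * integral {1..T} ?g) / T"
        using elim by (intro divide_right_mono) auto
      hence "\<bar>H T - F T\<bar> \<le> d T * F T + (1 + 1 / d T) * G T"
        using elim by (simp add: H_def F_def G_def add_divide_distrib diff_divide_distrib[symmetric] abs_divide)
      moreover have "G T / d T \<le> sqrt (G T)"
      proof -
        have "G T = sqrt (G T) * sqrt (G T)" using G0 by simp
        also have "\<dots> \<le> sqrt (G T) * d T" using G0 elim by (intro mult_left_mono) (auto simp: d_def)
        finally show ?thesis using dpos by (simp add: pos_divide_le_eq)
      qed
      ultimately show ?case by (simp add: algebra_simps)
    qed
  qed
  from tendsto_add[OF this F] show ?thesis by (simp add: H_def)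
qed

text \<open>The series may start at n = 0, since 0 powr a = 0.\<close>
lemma mean_square_dirichlet_sum:
  fixes \<sigma> \<eta> T :: real
  assumes "\<sigma> > 1/2" "0 < \<eta>" "\<eta> \<le> 1/2" "T \<ge> 1" "0 < N"
  shows "\<bar>integral {1..T} (\<lambda>t. (cmod (\<Sum>n=1..N. of_nat n powr (- Complex \<sigma> t)))\<^sup>2)
       - (T - 1) * (\<Sum>n=1..N. real n powr (- 2 * \<sigma>))\<bar>
    \<le> (2 * (\<Sum>n. real n powr (- 2 * \<sigma>)) + 4 * (\<Sum>k. real k powr (- 1 - \<eta>))) * real N powr (1 + \<eta>)"
proof -
  define Z where "Z = (\<Sum>k. real k powr (- 1 - \<eta>))"
  define Y where "Y = (\<Sum>n. real n powr (- 2 * \<sigma>))"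
  have Z: "Z \<ge> 0" unfolding Z_def using assms by (intro suminf_nonneg) (auto simp: summable_real_powr_iff)
  have Ys: "summable (\<lambda>n. real n powr (- 2 * \<sigma>))" using assms by (simp add: summable_real_powr_iff)
  have Y: "Y \<ge> 0" unfolding Y_def by (intro suminf_nonneg Ys) auto
  have NN: "real N \<le> real N powr (1 + \<eta>)"
    using assms powr_mono[of 1 "1 + \<eta>" "real N"] by simp
  have "\<bar>integral {1..T} (\<lambda>t. (cmod (\<Sum>n=1..N. of_nat n powr (- Complex \<sigma> t)))\<^sup>2)
       - (T - 1) * (\<Sum>n=1..N. real n powr (- 2 * \<sigma>))\<bar>
     \<le> 2 * (\<Sum>n=1..N. real n powr (- \<sigma>))\<^sup>2 + 4 * Z * (\<Sum>n=1..N. real n powr (1 - 2 * \<sigma> + \<eta>))"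
    using mean_square_shifted_dirichlet_sum[of "{1..N}" 0 \<eta> \<sigma> T] assms by (simp add: Z_def)
  also have "\<dots> \<le> 2 * (Y * real N powr (1 + \<eta>)) + 4 * Z * real N powr (1 + \<eta>)"
  proof (intro add_mono mult_left_mono)
    \<comment> \<open>Cauchy-Schwarz costs one factor N, while the squares have a bounded sum
      because 2 * \<sigma> > 1. This treats \<sigma> below, at and above 1 alike.\<close>
    have "(\<Sum>n=1..N. real n powr (- \<sigma>))\<^sup>2 \<le> (\<Sum>n=1..N. (real n powr (- \<sigma>))\<^sup>2) * card {1..N}"
      by (rule sum_squared_le_sum_of_squares)
    also have "(\<Sum>n=1..N. (real n powr (- \<sigma>))\<^sup>2) = (\<Sum>n=1..N. real n powr (- 2 * \<sigma>))"
      by (simp add: power2_eq_square flip: powr_add)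
    also have "(\<Sum>n=1..N. real n powr (- 2 * \<sigma>)) * card {1..N} \<le> Y * real N powr (1 + \<eta>)"
      using NN Y unfolding Y_def by (intro mult_mono sum_le_suminf Ys) auto
    finally show "(\<Sum>n=1..N. real n powr (- \<sigma>))\<^sup>2 \<le> Y * real N powr (1 + \<eta>)" .
    have "(\<Sum>n=1..N. real n powr (1 - 2 * \<sigma> + \<eta>)) \<le> (\<Sum>n=1..N. real N powr \<eta>)"
    proof (rule sum_mono)
      fix n assume n: "n \<in> {1..N}"
      have "real n powr (1 - 2 * \<sigma> + \<eta>) \<le> real n powr \<eta>" using n assms by (intro powr_mono) auto
      also have "\<dots> \<le> real N powr \<eta>" using n assms by (intro powr_mono2) auto
      finally show "real n powr (1 - 2 * \<sigma> + \<eta>) \<le> real N powr \<eta>" .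
    qed
    also have "\<dots> = real N powr (1 + \<eta>)" using assms by (simp add: powr_add)
    finally show "(\<Sum>n=1..N. real n powr (1 - 2 * \<sigma> + \<eta>)) \<le> real N powr (1 + \<eta>)" .
  qed (use Z in auto)
  finally show ?thesis by (simp add: Y_def Z_def algebra_simps)
qed

section \<open>The mean square of the zeta function\<close>

lemma zeta_real_eq:
  assumes "x > 1"
  shows "Re (zeta (of_real x)) = (\<Sum>n. real n powr (- x))" "Re (zeta (of_real x)) > 0"
proof -
  have "zeta (of_real x) = zeta_ext (of_real x)"
    using assms by (intro zeta_eq_zeta_ext) (auto simp: complex_eq_iff)
  with zeta_ext_sums[of "of_real x"] have "(\<lambda>n. 1 / of_nat (Suc n) powr of_real x) sums zeta (of_real x)"
    using assms by simp
  hence "(\<lambda>n. Re (1 / of_nat (Suc n) powr of_real x)) sums Re (zeta (of_real x))" by (rule sums_Re)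
  moreover have "Re (1 / of_nat (Suc n) powr of_real x) = real (Suc n) powr (- x)" for n
    using powr_of_real[of "real (Suc n)" x] by (simp add: powr_minus divide_inverse del: of_nat_Suc flip: of_real_inverse)
  ultimately have *: "(\<lambda>n. real (Suc n) powr (- x)) sums Re (zeta (of_real x))" by simp
  hence "(\<lambda>n. real n powr (- x)) sums Re (zeta (of_real x))"
    using sums_Suc_iff[of "\<lambda>n. real n powr (- x)"] by simp
  thus "Re (zeta (of_real x)) = (\<Sum>n. real n powr (- x))" by (rule sums_unique)
  show "Re (zeta (of_real x)) > 0"
    using suminf_pos[of "\<lambda>n. real (Suc n) powr (- x)"] * by (simp add: sums_iff)
qed

theorem zeta_mean_square:
  fixes \<sigma> :: real
  assumes "\<sigma> > 1/2"
  shows "((\<lambda>T. integral {1..T} (\<lambda>t. (cmod (zeta (Complex \<sigma> t)))\<^sup>2) / T) \<longlongrightarrow> Re (zeta (of_real (2 * \<sigma>)))) at_top"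
proof -
  \<comment> \<open>With N of size T powr a, the error terms are negligible under exp1 (sum), exp2 and exp3 (integral) below.\<close>
  define e where "e = \<sigma> - 1/2"
  define \<eta> where "\<eta> = e / (1 + e) / 2"
  define a where "a = 1 - \<eta>"
  have e: "e > 0" using assms by (simp add: e_def)
  \<comment> \<open>\<eta> is chosen for the last identity. It turns the three products below into 1
    - \<eta>^2, 1 + e + \<eta>^2 and 2 + e respectively.\<close>
  have \<eta>: "0 < \<eta>" "\<eta> \<le> 1/2" "\<eta> * (1 + e) = e / 2" using e by (auto simp: \<eta>_def field_simps)
  have \<sigma>: "\<sigma> = e + 1/2" by (simp add: e_def)
  have a: "a > 0" using \<eta> by (simp add: a_def)
  have \<eta>sq: "\<eta> * \<eta> > 0" using \<eta> by simp
  have exp1: "a * (1 + \<eta>) < 1" using \<eta>sq by (simp add: a_def algebra_simps)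
  have exp2: "a * (2 * \<sigma> - \<eta>) > 1"
    using \<eta>(3) \<eta>sq e by (simp add: a_def \<sigma> algebra_simps)
  have exp3: "a * (2 * \<sigma> + 1) > 2"
    using \<eta>(3) e by (simp add: a_def \<sigma> algebra_simps)
  define N where "N = (\<lambda>T::real. nat \<lceil>T powr a\<rceil>)"
  \<comment> \<open>Rounding up costs at most a factor 2 because T powr a \<ge> 1.\<close>
  have N: "N T \<ge> 1" "real (N T) \<ge> T powr a" "real (N T) \<le> 2 * T powr a" if "T \<ge> 1" for T
  proof -
    have "T powr a \<ge> 1" using that a by (simp add: ge_one_powr_ge_zero)
    thus "N T \<ge> 1" "real (N T) \<ge> T powr a" "real (N T) \<le> 2 * T powr a"
      unfolding N_def by linarith+
  qed
  have N_lower: "real (N T) powr (- q) \<le> T powr (- (a * q))" if "T \<ge> 1" "q \<ge> 0" for T q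
  proof -
    have "real (N T) powr (- q) \<le> (T powr a) powr (- q)" using that N by (intro powr_mono2') auto
    thus ?thesis by (simp add: powr_powr)
  qed
  have lim0: "((\<lambda>T::real. c * T powr q) \<longlongrightarrow> 0) at_top" if "q < 0" for c q
    using tendsto_mult_right_zero[OF tendsto_neg_powr[OF that filterlim_ident]] by simp
  have filterN: "filterlim (\<lambda>T. N T) sequentially at_top"
  proof -
    have "filterlim (\<lambda>T. T powr a) at_top at_top"
      using a by (rule real_powr_at_top)
    hence "filterlim (\<lambda>T. real (N T)) at_top at_top"
      by (rule filterlim_at_top_mono) (use N in \<open>auto intro!: eventually_mono[OF eventually_ge_at_top[of 1]]\<close>)
    thus ?thesis by (simp add: filterlim_sequentially_iff_filterlim_real)
  qed
  define A where "A = (\<lambda>T t. \<Sum>n=1..N T. of_nat n powr (- Complex \<sigma> t))"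
  define B where "B = (\<lambda>T t. of_nat (N T) powr (1 - Complex \<sigma> t) / (Complex \<sigma> t - 1))"
  define E where "E = (\<lambda>T t. \<Sum>k. frac_term (k + N T) (Complex \<sigma> t))"
  define D where "D = (\<lambda>T t. - Complex \<sigma> t * E T t)"
  have contA: "continuous_on {1..T} (A T)" for T
    unfolding A_def Complex_eq by (intro continuous_intros) (auto simp: complex_nonpos_Reals_iff)
  have contB: "continuous_on {1..T} (B T)" for T
  proof (cases "T \<ge> 1")
    case True
    thus ?thesis unfolding B_def Complex_eq using N(1)[OF True]
      by (intro continuous_intros) (auto simp: complex_eq_iff)
  qed auto
  have contE: "continuous_on {1..T} (E T)" for T
  proof (cases "T \<ge> 1")
    case True
    thus ?thesis unfolding E_def using N(1)[OF True] assms
      by (intro continuous_on_frac_term_suminf) auto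
  qed auto
  have contD: "continuous_on {1..T} (D T)" for T
    unfolding D_def Complex_eq by (intro continuous_intros contE)
  let ?Y = "\<Sum>n. real n powr (- 2 * \<sigma>)"
  have Ys: "summable (\<lambda>n. real n powr (- 2 * \<sigma>))" using assms by (simp add: summable_real_powr_iff)
  have limA: "((\<lambda>T. integral {1..T} (\<lambda>t. (cmod (A T t))\<^sup>2) / T) \<longlongrightarrow> ?Y) at_top"
  proof -
    define c where "c = 2 * ?Y + 4 * (\<Sum>k. real k powr (- 1 - \<eta>))"
    have c: "c \<ge> 0" unfolding c_def using \<eta> Ys
      by (intro add_nonneg_nonneg mult_nonneg_nonneg suminf_nonneg) (auto simp: summable_real_powr_iff)
    \<comment> \<open>The diagonal contribution divided by T; the factor 1 - 1 / T is due to the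
      integration starting at 1.\<close>
    let ?M = "\<lambda>T. (1 - 1 / T) * (\<Sum>n=1..N T. real n powr (- 2 * \<sigma>))"
    have "(\<lambda>m. \<Sum>n<Suc m. real n powr (- 2 * \<sigma>)) \<longlonglongrightarrow> ?Y"
      by (intro LIMSEQ_Suc summable_LIMSEQ Ys)
    also have "(\<lambda>m. \<Sum>n<Suc m. real n powr (- 2 * \<sigma>)) = (\<lambda>m. \<Sum>n=1..m. real n powr (- 2 * \<sigma>))"
      by (intro ext sum.mono_neutral_right) auto
    finally have s: "((\<lambda>T. \<Sum>n=1..N T. real n powr (- 2 * \<sigma>)) \<longlongrightarrow> ?Y) at_top"
      by (rule filterlim_compose[OF _ filterN])
    have "((\<lambda>T::real. 1 / T) \<longlongrightarrow> 0) at_top"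
      by (intro tendsto_divide_0[OF tendsto_const] filterlim_at_top_imp_at_infinity filterlim_ident)
    hence M: "(?M \<longlongrightarrow> (1 - 0) * ?Y) at_top" by (intro tendsto_intros s)
    have "((\<lambda>T. integral {1..T} (\<lambda>t. (cmod (A T t))\<^sup>2) / T - ?M T) \<longlongrightarrow> 0) at_top"
    proof (rule Lim_null_comparison)
      show "((\<lambda>T. (c * 2 powr (1 + \<eta>)) * T powr (a * (1 + \<eta>) - 1)) \<longlongrightarrow> 0) at_top"
        by (rule lim0) (use exp1 in simp)
      show "\<forall>\<^sub>F T in at_top. norm (integral {1..T} (\<lambda>t. (cmod (A T t))\<^sup>2) / T - ?M T)
          \<le> (c * 2 powr (1 + \<eta>)) * T powr (a * (1 + \<eta>) - 1)"
        using eventually_ge_at_top[of 1]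
      proof eventually_elim
        case (elim T)
        have eq: "integral {1..T} (\<lambda>t. (cmod (A T t))\<^sup>2) / T - ?M T =
           (integral {1..T} (\<lambda>t. (cmod (A T t))\<^sup>2) - (T - 1) * (\<Sum>n=1..N T. real n powr (- 2 * \<sigma>))) / T"
          using elim by (simp add: field_simps)
        have "norm (integral {1..T} (\<lambda>t. (cmod (A T t))\<^sup>2) / T - ?M T) \<le> c * real (N T) powr (1 + \<eta>) / T"
          unfolding eq real_norm_def abs_divide
          using mean_square_dirichlet_sum[OF assms \<eta>(1,2) elim, of "N T"] N(1)[OF elim] elim
          by (simp add: A_def c_def divide_right_mono)
        also have "\<dots> \<le> c * (2 * T powr a) powr (1 + \<eta>) / T"
          using N[OF elim] c elim \<eta> by (intro divide_right_mono mult_left_mono powr_mono2) auto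
        also have "\<dots> = (c * 2 powr (1 + \<eta>)) * T powr (a * (1 + \<eta>) - 1)"
          using elim by (simp add: powr_mult powr_powr powr_diff)
        finally show ?case .
      qed
    qed
    from tendsto_add[OF this M] show ?thesis by simp
  qed
  have limB: "((\<lambda>T. integral {1..T} (\<lambda>t. (cmod (B T t))\<^sup>2) / T) \<longlongrightarrow> 0) at_top"
  proof (rule Lim_null_comparison)
    show "((\<lambda>T. 2 * T powr (a - 1)) \<longlongrightarrow> 0) at_top"
      by (rule lim0) (use \<eta> in \<open>simp add: a_def\<close>)
    show "\<forall>\<^sub>F T in at_top. norm (integral {1..T} (\<lambda>t. (cmod (B T t))\<^sup>2) / T) \<le> 2 * T powr (a - 1)"
      using eventually_ge_at_top[of 1]
    proof eventually_elim
      case (elim T)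
      \<comment> \<open>On the range of integration |s - 1| \<ge> t \<ge> 1, away from the pole, and
        2 - 2 * \<sigma> \<le> 1. As 1 / t^2 is integrable up to infinity, the whole integral is at
        most N, which is o(T).\<close>
      have bound: "(cmod (B T t))\<^sup>2 \<le> real (N T) * (1 / t\<^sup>2)" if t: "t \<in> {1..T}" for t
      proof -
        have "cmod (of_nat (N T) powr (1 - Complex \<sigma> t)) = real (N T) powr (1 - \<sigma>)"
          using cmod_of_real_powr[of "real (N T)" "1 - Complex \<sigma> t"] N(1)[OF elim] by simp
        hence "(cmod (B T t))\<^sup>2 = real (N T) powr (2 - 2 * \<sigma>) / (cmod (Complex \<sigma> t - 1))\<^sup>2"
          by (simp add: B_def norm_divide power_divide power2_eq_square flip: powr_add)
        also have "\<dots> \<le> real (N T) powr 1 / t\<^sup>2"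
          using N(1)[OF elim] assms t by (intro frac_le powr_mono) (auto simp: cmod_power2)
        finally show ?thesis using N(1)[OF elim] by simp
      qed
      have hi: "((\<lambda>t. 1 / t\<^sup>2) has_integral (- (1 / T) - - (1 / 1))) {1..T}"
        using elim by (intro fundamental_theorem_of_calculus)
          (auto intro!: derivative_eq_intros simp: power2_eq_square simp flip: has_real_derivative_iff_has_vector_derivative)
      have "integral {1..T} (\<lambda>t. (cmod (B T t))\<^sup>2) \<le> integral {1..T} (\<lambda>t. real (N T) * (1 / t\<^sup>2))"
        using hi by (intro integral_le integrable_continuous_interval continuous_intros contB bound) auto
      also have "\<dots> = real (N T) * (1 - 1 / T)"
        using has_integral_mult_right[OF hi, of "real (N T)"] by (intro integral_unique) simp
      also have "\<dots> \<le> real (N T) * 1" using elim by (intro mult_left_mono) auto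
      also have "\<dots> \<le> 2 * T powr a" using N(3)[OF elim] by simp
      finally have "integral {1..T} (\<lambda>t. (cmod (B T t))\<^sup>2) / T \<le> 2 * T powr a / T"
        using elim by (intro divide_right_mono) auto
      moreover have "integral {1..T} (\<lambda>t. (cmod (B T t))\<^sup>2) \<ge> 0"
        by (intro integral_nonneg integrable_continuous_interval continuous_intros contB) auto
      ultimately show ?case using elim by (simp add: powr_diff)
    qed
  qed
  have limD: "((\<lambda>T. integral {1..T} (\<lambda>t. (cmod (D T t))\<^sup>2) / T) \<longlongrightarrow> 0) at_top"
  proof -
    obtain C where C: "C \<ge> 0" "\<And>N T. N \<ge> 1 \<Longrightarrow> T \<ge> 1 \<Longrightarrow>
      integral {1..T} (\<lambda>t. (cmod (\<Sum>k. frac_term (k + N) (Complex \<sigma> t)))\<^sup>2)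
      \<le> C * (T * real N powr (- (2 * \<sigma> + 1)) + real N powr (- (2 * \<sigma> - \<eta>)))"
      using mean_square_frac_term_suminf[of \<eta> \<sigma>] \<eta> assms by auto
    \<comment> \<open>The square of |s| is at most (\<sigma>^2 + 1) * T^2. With the division by T
      this leaves the exponents 2 - a * (2 * \<sigma> + 1) and 1 - a * (2 * \<sigma> - \<eta>),
      negative by \<open>exp3\<close> and \<open>exp2\<close>.\<close>
    let ?c = "(\<sigma>\<^sup>2 + 1) * C"
    show ?thesis
    proof (rule Lim_null_comparison)
      have "((\<lambda>T. ?c * T powr (2 - a * (2 * \<sigma> + 1)) + ?c * T powr (1 - a * (2 * \<sigma> - \<eta>))) \<longlongrightarrow> 0 + 0) at_top"
        by (intro tendsto_add lim0) (use exp2 exp3 in auto)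
      thus "((\<lambda>T. ?c * T powr (2 - a * (2 * \<sigma> + 1)) + ?c * T powr (1 - a * (2 * \<sigma> - \<eta>))) \<longlongrightarrow> 0) at_top" by simp
      show "\<forall>\<^sub>F T in at_top. norm (integral {1..T} (\<lambda>t. (cmod (D T t))\<^sup>2) / T)
        \<le> ?c * T powr (2 - a * (2 * \<sigma> + 1)) + ?c * T powr (1 - a * (2 * \<sigma> - \<eta>))"
        using eventually_ge_at_top[of 1]
      proof eventually_elim
        case (elim T)
        have bound: "(cmod (D T t))\<^sup>2 \<le> ((\<sigma>\<^sup>2 + 1) * T\<^sup>2) * (cmod (E T t))\<^sup>2" if t: "t \<in> {1..T}" for t
        proof -
          have "t\<^sup>2 \<le> T\<^sup>2" "1 \<le> T\<^sup>2" using t elim by (auto intro: power_mono)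
          moreover have "\<sigma>\<^sup>2 * 1 \<le> \<sigma>\<^sup>2 * T\<^sup>2" using \<open>1 \<le> T\<^sup>2\<close> by (intro mult_left_mono) auto
          ultimately have "(cmod (Complex \<sigma> t))\<^sup>2 \<le> (\<sigma>\<^sup>2 + 1) * T\<^sup>2"
            by (simp add: cmod_power2 algebra_simps)
          thus ?thesis unfolding D_def norm_mult norm_minus_cancel power_mult_distrib by (rule mult_right_mono) simp
        qed
        have "integral {1..T} (\<lambda>t. (cmod (D T t))\<^sup>2) \<le> integral {1..T} (\<lambda>t. ((\<sigma>\<^sup>2 + 1) * T\<^sup>2) * (cmod (E T t))\<^sup>2)"
          by (intro integral_le integrable_continuous_interval continuous_intros contD contE bound)
        also have "\<dots> = ((\<sigma>\<^sup>2 + 1) * T\<^sup>2) * integral {1..T} (\<lambda>t. (cmod (E T t))\<^sup>2)" by simp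
        also have "\<dots> \<le> ((\<sigma>\<^sup>2 + 1) * T\<^sup>2) * (C * (T * real (N T) powr (- (2 * \<sigma> + 1)) + real (N T) powr (- (2 * \<sigma> - \<eta>))))"
          unfolding E_def using C(2)[OF N(1)[OF elim] elim] by (intro mult_left_mono) auto
        also have "\<dots> \<le> ((\<sigma>\<^sup>2 + 1) * T\<^sup>2) * (C * (T * T powr (- (a * (2 * \<sigma> + 1))) + T powr (- (a * (2 * \<sigma> - \<eta>)))))"
          using C(1) elim assms \<eta> by (intro mult_left_mono add_mono N_lower) auto
        also have "\<dots> = (?c * T powr (2 - a * (2 * \<sigma> + 1)) + ?c * T powr (1 - a * (2 * \<sigma> - \<eta>))) * T"
        proof -
          have pw: "T powr (2 - p) = T\<^sup>2 * T powr (- p)" "T powr (1 - p) = T * T powr (- p)" for p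
            using elim powr_add[of T 2 "- p"] powr_add[of T 1 "- p"] by simp_all
          have "s * T\<^sup>2 * (C * (T * v + w)) = (s * C * (T\<^sup>2 * v) + s * C * (T * w)) * T" for s v w
            by (simp add: power2_eq_square algebra_simps)
          thus ?thesis unfolding pw .
        qed
        finally have "integral {1..T} (\<lambda>t. (cmod (D T t))\<^sup>2) / T
            \<le> ?c * T powr (2 - a * (2 * \<sigma> + 1)) + ?c * T powr (1 - a * (2 * \<sigma> - \<eta>))"
          using elim by (simp add: pos_divide_le_eq)
        moreover have "integral {1..T} (\<lambda>t. (cmod (D T t))\<^sup>2) \<ge> 0"
          by (intro integral_nonneg integrable_continuous_interval continuous_intros contD) auto
        ultimately show ?case using elim by simp
      qed
    qed
  qed
  \<comment> \<open>Two perturbations in turn: B is added to the main sum A, then D to A +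
    B.\<close>
  have "((\<lambda>T. integral {1..T} (\<lambda>t. (cmod ((A T t + B T t) + D T t))\<^sup>2) / T) \<longlongrightarrow> ?Y) at_top"
    by (intro mean_square_perturb[where f = "\<lambda>T t. A T t + B T t"] mean_square_perturb
        contA contB contD limA limB limD continuous_intros)
  moreover have "\<forall>\<^sub>F T in at_top. integral {1..T} (\<lambda>t. (cmod ((A T t + B T t) + D T t))\<^sup>2) / T
     = integral {1..T} (\<lambda>t. (cmod (zeta (Complex \<sigma> t)))\<^sup>2) / T"
    using eventually_ge_at_top[of 1]
  proof eventually_elim
    case (elim T)
    have "zeta (Complex \<sigma> t) = (A T t + B T t) + D T t" if "t \<in> {1..T}" for t
    proof -
      have ne: "Re (Complex \<sigma> t) > 0" "Complex \<sigma> t \<noteq> 1" using that assms by (auto simp: complex_eq_iff)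
      show ?thesis
        using zeta_eq_zeta_ext[OF ne] zeta_ext_eq[OF ne N(1)[OF elim]]
        by (simp add: A_def B_def D_def E_def)
    qed
    thus ?case by (intro arg_cong2[where f = "(/)"] integral_cong refl) simp
  qed
  ultimately have "((\<lambda>T. integral {1..T} (\<lambda>t. (cmod (zeta (Complex \<sigma> t)))\<^sup>2) / T) \<longlongrightarrow> ?Y) at_top"
    by (rule Lim_transform_eventually)
  thus ?thesis using zeta_real_eq(1)[of "2 * \<sigma>"] assms by simp
qed

section \<open>The functional K\<close>

lemma tendsto_ratio_of_bigo:
  fixes F g :: "real \<Rightarrow> real"
  assumes "(\<lambda>T. F T - c * T) \<in> O(g)" "((\<lambda>T. g T / T) \<longlongrightarrow> 0) at_top"
  shows "((\<lambda>T. F T / T) \<longlongrightarrow> c) at_top"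
proof -
  have "g \<in> o(\<lambda>T. T)"
    by (intro smalloI_tendsto assms(2)) (auto intro: eventually_mono[OF eventually_gt_at_top[of 0]])
  hence "(\<lambda>T. F T - c * T) \<in> o(\<lambda>T. T)" by (rule landau_o.big_small_trans[OF assms(1)])
  hence "((\<lambda>T. (F T - c * T) / T) \<longlongrightarrow> 0) at_top" by (rule smalloD_tendsto)
  hence "((\<lambda>T. (F T - c * T) / T + c) \<longlongrightarrow> 0 + c) at_top" by (intro tendsto_intros)
  hence lim: "((\<lambda>T. (F T - c * T) / T + c) \<longlongrightarrow> c) at_top" by simp
  show ?thesis
    by (rule Lim_transform_eventually[OF lim])
       (auto intro!: eventually_mono[OF eventually_gt_at_top[of 0]] simp: field_simps)
qed

lemma tendsto_rescale:
  fixes F :: "real \<Rightarrow> real"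
  assumes "((\<lambda>T. F T / T) \<longlongrightarrow> c) at_top" "q > 0"
  shows "((\<lambda>\<tau>. F (q * \<tau>) / \<tau>) \<longlongrightarrow> q * c) at_top"
proof -
  have "filterlim (\<lambda>\<tau>. q * \<tau>) at_top at_top"
    using assms(2) by (intro filterlim_tendsto_pos_mult_at_top[OF tendsto_const]) (auto simp: filterlim_ident)
  from filterlim_compose[OF assms(1) this] have "((\<lambda>\<tau>. F (q * \<tau>) / (q * \<tau>)) \<longlongrightarrow> c) at_top" .
  hence "((\<lambda>\<tau>. q * (F (q * \<tau>) / (q * \<tau>))) \<longlongrightarrow> q * c) at_top" by (intro tendsto_intros)
  thus ?thesis using assms(2) by simp
qed

text \<open>Needed to divide by 1 - c. The standard upper estimate at index 0 reads 1 - ln 2 + 1/2,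
  and ln 2 > 1/2 brings it below 1.\<close>

lemma euler_mascheroni_less_one: "euler_mascheroni < (1 :: real)"
proof -
  have "(euler_mascheroni :: real) \<le> harm (Suc 0) - ln (real_of_nat (0 + 2)) + 1 / real_of_nat (2 * (0 + 1))"
    by (rule euler_mascheroni_upper)
  moreover have "ln (2 :: real) > 1 / 2" using ln2_ge_two_thirds by simp
  ultimately show ?thesis by (simp add: harm_def)
qed

text \<open>Each integral divided by its upper or lower endpoint T tends to its normalising
  constant, which is positive and cancels. As r > 0 is fixed, T = r / 3 * \<tau> tends to infinity
  with \<tau>, and passing from 1 / T to 1 / \<tau> produces the factor r / 3.\<close>

lemma K_eq:
  assumes "\<sigma> > 1/2" "selberg_constant l C" "jacobs_ladder T0 \<phi>" "x \<ge> 1" "z \<ge> 1"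
  shows "K \<sigma> l C (ladder_inv T0 \<phi>) x y z n = (real x ^ n + real y ^ n) / real z ^ n"
proof -
  define r where "r = (real x ^ n + real y ^ n) / real z ^ n"
  define psi where "psi = ladder_inv T0 \<phi>"
  have "r > 0" unfolding r_def using assms by (intro divide_pos_pos add_pos_nonneg) auto
  hence q: "r / 3 > 0" by simp
  define F1 where "F1 = (\<lambda>T. integral {T..psi T} (\<lambda>t. (cmod (zeta (Complex (1/2) t)))\<^sup>2))"
  define F2 where "F2 = (\<lambda>T. integral {1..T} (\<lambda>t. (cmod (zeta (Complex \<sigma> t)))\<^sup>2))"
  define F3 where "F3 = (\<lambda>T. integral {1..T} (\<lambda>t. \<bar>S1 t\<bar> ^ (2 * l)))"
  define c1 where "c1 = 1 - (euler_mascheroni :: real)"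
  define c2 where "c2 = Re (zeta (of_real (2 * \<sigma>)))"
  have pos: "c1 > 0" "c2 > 0" "C > 0"
    using euler_mascheroni_less_one zeta_real_eq(2)[of "2 * \<sigma>"] assms(1,2)
    by (simp_all add: c1_def c2_def selberg_constant_def)
  have "((\<lambda>T. F1 T / T) \<longlongrightarrow> c1) at_top"
  proof -
    have "\<forall>\<^sub>F \<delta> in at_right 0. (\<lambda>T. F1 T - c1 * T) \<in> O(\<lambda>T. T powr (1/3 + \<delta>))"
      using assms(3) by (simp add: jacobs_ladder_def F1_def c1_def psi_def)
    moreover have "\<forall>\<^sub>F \<delta> in at_right (0::real). \<delta> < 1/3"
      by (intro eventually_at_rightI[of 0 "1/3"]) auto
    \<comment> \<open>A single admissible \<delta> < 1/3 is enough: it makes the exponent 1/3 +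
      \<delta> less than 1, so the error of the ladder is o(T).\<close>
    ultimately have "\<forall>\<^sub>F \<delta> in at_right 0. (\<lambda>T. F1 T - c1 * T) \<in> O(\<lambda>T. T powr (1/3 + \<delta>)) \<and> \<delta> < 1/3"
      by (rule eventually_conj)
    then obtain \<delta> where \<delta>: "(\<lambda>T. F1 T - c1 * T) \<in> O(\<lambda>T. T powr (1/3 + \<delta>))" "\<delta> < 1/3"
      using eventually_happens'[OF trivial_limit_at_right_real] by blast
    define p where "p = 1/3 + \<delta>"
    have lim: "((\<lambda>T::real. T powr (p - 1)) \<longlongrightarrow> 0) at_top"
      using \<delta>(2) by (intro tendsto_neg_powr filterlim_ident) (simp add: p_def)
    have "((\<lambda>T::real. T powr p / T) \<longlongrightarrow> 0) at_top"
      by (rule Lim_transform_eventually[OF lim])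
         (auto intro!: eventually_mono[OF eventually_gt_at_top[of 0]] simp: powr_diff)
    with \<delta>(1) show ?thesis unfolding p_def by (rule tendsto_ratio_of_bigo)
  qed
  note l1 = tendsto_rescale[OF this q]
  have "((\<lambda>T. F2 T / T) \<longlongrightarrow> c2) at_top"
    unfolding F2_def c2_def by (rule zeta_mean_square[OF assms(1)])
  note l2 = tendsto_rescale[OF this q]
  have "((\<lambda>T. F3 T / T) \<longlongrightarrow> C) at_top"
  proof (rule tendsto_ratio_of_bigo)
    show "(\<lambda>T. F3 T - C * T) \<in> O(\<lambda>T. T / ln T)"
      using assms(2) by (simp add: selberg_constant_def F3_def)
    have lim: "((\<lambda>T::real. 1 / ln T) \<longlongrightarrow> 0) at_top"
      by (intro tendsto_divide_0[OF tendsto_const] filterlim_at_top_imp_at_infinity ln_at_top)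
    show "((\<lambda>T::real. T / ln T / T) \<longlongrightarrow> 0) at_top"
      by (rule Lim_transform_eventually[OF lim])
         (auto intro!: eventually_mono[OF eventually_gt_at_top[of 0]])
  qed
  note l3 = tendsto_rescale[OF this q]
  have "((\<lambda>\<tau>. 1 / c1 * (F1 (r / 3 * \<tau>) / \<tau>) + 1 / c2 * (F2 (r / 3 * \<tau>) / \<tau>) + 1 / C * (F3 (r / 3 * \<tau>) / \<tau>))
     \<longlongrightarrow> 1 / c1 * (r / 3 * c1) + 1 / c2 * (r / 3 * c2) + 1 / C * (r / 3 * C)) at_top"
    by (intro tendsto_intros l1 l2 l3)
  also have "1 / c1 * (r / 3 * c1) + 1 / c2 * (r / 3 * c2) + 1 / C * (r / 3 * C) = r"
    using pos by simp
  also have "(\<lambda>\<tau>. 1 / c1 * (F1 (r / 3 * \<tau>) / \<tau>) + 1 / c2 * (F2 (r / 3 * \<tau>) / \<tau>) + 1 / C * (F3 (r / 3 * \<tau>) / \<tau>))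
     = (\<lambda>\<tau>. 1 / \<tau> * (1 / c1 * F1 (r / 3 * \<tau>) + 1 / c2 * F2 (r / 3 * \<tau>) + 1 / C * F3 (r / 3 * \<tau>)))"
    by (simp add: add_divide_distrib)
  finally have "Lim at_top (\<lambda>\<tau>. 1 / \<tau> * (1 / c1 * F1 (r / 3 * \<tau>) + 1 / c2 * F2 (r / 3 * \<tau>) + 1 / C * F3 (r / 3 * \<tau>))) = r"
    by (intro tendsto_Lim) auto
  thus ?thesis
    unfolding K_def Let_def r_def[symmetric] c1_def c2_def F1_def F2_def F3_def psi_def .
qed

theorem theorem2:
  fixes \<epsilon> \<sigma> C T0 :: real and l :: nat and \<phi> :: "real \<Rightarrow> real"
  assumes "\<epsilon> > 0" and "\<sigma> \<ge> 1/2 + \<epsilon>" and "l \<ge> 1"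
    and "selberg_constant l C"
    and "jacobs_ladder T0 \<phi>"
  shows "(\<not> (\<exists>(x::nat) (y::nat) (z::nat) (n::nat). x \<ge> 1 \<and> y \<ge> 1 \<and> z \<ge> 1 \<and> n \<ge> 3 \<and> x ^ n + y ^ n = z ^ n))
     \<longleftrightarrow> (\<forall>(x::nat) (y::nat) (z::nat) (n::nat). x \<ge> 1 \<and> y \<ge> 1 \<and> z \<ge> 1 \<and> n \<ge> 3 \<longrightarrow>
            K \<sigma> l C (ladder_inv T0 \<phi>) x y z n \<noteq> 1)"
proof -
  \<comment> \<open>The correspondence holds for each quadruple separately, so the equivalence is
    obtained without deciding either side. Positivity of z permits clearing the denominator, and
    injectivity of \<open>of_nat\<close> returns the equation to the natural numbers.\<close>
  have "K \<sigma> l C (ladder_inv T0 \<phi>) x y z n = 1 \<longleftrightarrow> x ^ n + y ^ n = z ^ n" if "x \<ge> 1" "z \<ge> 1" for x y z n :: nat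
  proof -
    have "K \<sigma> l C (ladder_inv T0 \<phi>) x y z n = (real x ^ n + real y ^ n) / real z ^ n"
      using assms that by (intro K_eq) auto
    also have "\<dots> = 1 \<longleftrightarrow> real (x ^ n + y ^ n) = real (z ^ n)"
      using that divide_eq_1_iff[of "real x ^ n + real y ^ n" "real z ^ n"] by simp
    finally show ?thesis unfolding of_nat_eq_iff .
  qed
  thus ?thesis by metis
qed

end
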